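(* Let $t \geq 2$ be an integer and set $n = 9t^2-3t+1$ and $r = 3t^2-2t+1$. Then the Cayley complement $\overline{C}(\mathbb{Z}_n,\{1,3t-1,3t\})$ is $r$-primitive.
   Context: For a finite group $\Gamma$ and a set $S\subseteq\Gamma$, the Cayley graph $C(\Gamma,S)$ has vertex set $\Gamma$, with distinct $x,y$ adjacent iff $x=yz$ or $x=yz^{-1}$ for some $z\in S$. For $\Gamma=\mathbb{Z}_n$ (written additively) this means distinct $x,y\in\mathbb{Z}_n$ are adjacent iff $x-y\equiv \pm s \pmod n$ for some $s\in S$. The Cayley complement $\overline{C}(\Gamma,S)$ is the (simple) graph complement of $C(\Gamma,S)$. A graph $G$ (with at least $r$ vertices) is uniquely $K_r$-saturated if $G$ contains no clique on $r$ vertices and, for every pair of nonadjacent vertices $u,v$, the graph $G+uv$ contains exactly one clique on $r$ vertices. A graph is $r$-primitive if it is uniquely $K_r$-saturated and has no dominating vertex (a vertex adjacent to all other vertices). *)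

theory Defs
  imports "HOL-Algebra.Elementary_Groups" "HOL-Library.Ramsey"
begin

text \<open>
  A graph is a pair of a vertex set and a set of two-element edges. Cliques are those of
  \<^theory>\<open>HOL-Library.Ramsey\<close>, which does not itself require the clique to consist of vertices.
\<close>

type_synonym 'a sgraph = "'a set \<times> 'a set set"

abbreviation vertices :: "'a sgraph \<Rightarrow> 'a set" where
  "vertices \<equiv> fst"

abbreviation edges :: "'a sgraph \<Rightarrow> 'a set set" where
  "edges \<equiv> snd"

definition finite_simple_graph :: "'a sgraph \<Rightarrow> bool" where
  "finite_simple_graph G \<longleftrightarrow>
     finite (vertices G) \<and> (\<forall>e\<in>edges G. e \<subseteq> vertices G \<and> card e = 2)"

definition adjacent :: "'a sgraph \<Rightarrow> 'a \<Rightarrow> 'a \<Rightarrow> bool" where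
  "adjacent G u v \<longleftrightarrow> {u, v} \<in> edges G"

definition add_edge :: "'a sgraph \<Rightarrow> 'a \<Rightarrow> 'a \<Rightarrow> 'a sgraph" where
  "add_edge G u v = (vertices G, insert {u, v} (edges G))"

definition graph_complement :: "'a sgraph \<Rightarrow> 'a sgraph" where
  "graph_complement G =
     (vertices G,
      {{x, y} | x y. x \<in> vertices G \<and> y \<in> vertices G \<and> x \<noteq> y \<and> \<not> adjacent G x y})"

definition is_clique_of_size :: "nat \<Rightarrow> 'a sgraph \<Rightarrow> 'a set \<Rightarrow> bool" where
  "is_clique_of_size r G K \<longleftrightarrow> K \<subseteq> vertices G \<and> card K = r \<and> clique K (edges G)"

definition uniquely_saturated :: "nat \<Rightarrow> 'a sgraph \<Rightarrow> bool" where
  "uniquely_saturated r G \<longleftrightarrow>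
     finite_simple_graph G \<and> r \<le> card (vertices G) \<and>
     (\<nexists>K. is_clique_of_size r G K) \<and>
     (\<forall>u\<in>vertices G. \<forall>v\<in>vertices G. u \<noteq> v \<and> \<not> adjacent G u v \<longrightarrow>
        (\<exists>!K. is_clique_of_size r (add_edge G u v) K))"

definition dominating_vertex :: "'a sgraph \<Rightarrow> 'a \<Rightarrow> bool" where
  "dominating_vertex G v \<longleftrightarrow>
     v \<in> vertices G \<and> (\<forall>u\<in>vertices G. u \<noteq> v \<longrightarrow> adjacent G v u)"

definition primitive_graph :: "nat \<Rightarrow> 'a sgraph \<Rightarrow> bool" where
  "primitive_graph r G \<longleftrightarrow> uniquely_saturated r G \<and> (\<nexists>v. dominating_vertex G v)"

definition cayley_graph :: "('a, 'b) monoid_scheme \<Rightarrow> 'a set \<Rightarrow> 'a sgraph" where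
  "cayley_graph \<Gamma> S =
     (carrier \<Gamma>,
      {{x, y} | x y. x \<in> carrier \<Gamma> \<and> y \<in> carrier \<Gamma> \<and> x \<noteq> y \<and>
         (\<exists>z\<in>S. x = y \<otimes>\<^bsub>\<Gamma>\<^esub> z \<or> x = y \<otimes>\<^bsub>\<Gamma>\<^esub> inv\<^bsub>\<Gamma>\<^esub> z)})"

definition cayley_complement :: "('a, 'b) monoid_scheme \<Rightarrow> 'a set \<Rightarrow> 'a sgraph" where
  "cayley_complement \<Gamma> S = graph_complement (cayley_graph \<Gamma> S)"

end

theory Submission
  imports Defs
begin

text \<open>
  Write \<open>w = 3 t\<close>. Modulo \<open>n\<close> we have \<open>w\<^sup>2 - w + 1 = 0\<close>, so the differences \<open>\<plusminus>1, \<plusminus>w, \<plusminus>(w - 1)\<close> of adjacent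
  vertices are the powers of \<open>w\<close>, a group of units, and every edge of the Cayley graph can be moved
  to \<open>{0, 3 t}\<close> by an automorphism \<open>x \<mapsto> u + m x\<close>. The claim becomes: no set of \<open>r\<close> residues is
  independent in the Cayley graph, and exactly one such set spans \<open>{0, 3 t}\<close> as its only edge.

  Lift a set of \<open>r\<close> residues to a periodic set \<open>X\<close> of integers and let \<open>Q = 2 X \<union> (2 X - s)\<close> with
  \<open>s = 6 t - 1\<close>. Then \<open>X\<close> is independent iff distinct elements of \<open>Q\<close> differ by at least 3, and the
  edge \<open>{0, 3 t}\<close> appears as the two neighbours 0 and 1 in \<open>Q\<close>. Let \<open>N\<close> count the elements of \<open>Q\<close>
  and let \<open>G q = q - 3 N q\<close>, corrected by 2 behind every copy of the edge. Along \<open>Q\<close> the function \<open>G\<close>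
  is nondecreasing, it grows strictly between neighbours of the same parity, and from an odd
  \<open>B \<in> Q\<close> to \<open>B + s \<in> Q\<close> it grows by an amount congruent to 2 modulo 3, hence by at least 2, unless the
  edge lies in between. Follow the path that goes from \<open>B\<close> to the next odd element after \<open>B + s\<close>. If there is no
  edge, \<open>G\<close> grows along it faster than the period of \<open>Q\<close> permits. If there is one edge, the total
  growth \<open>6 t - 2\<close> over a period leaves so little slack that \<open>N (B + s) = N B + 2 t - 1\<close> for
  all odd \<open>B \<in> Q\<close>. As \<open>(6 t - 1) (2 t - 1) = 4 r - 3\<close>, moving three places along \<open>Q\<close> flips the
  parity, which together with the bound on the growth of \<open>G\<close> makes the parities alternate. It follows that
  \<open>X\<close> is the set of all \<open>(3 t + 1) k - 1\<close> with \<open>1 \<le> k \<le> r\<close> modulo \<open>n\<close>. That this set works follows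
  from \<open>(3 t + 1) r = t n + 1\<close>.
\<close>

section \<open>Counting in periodic sets of integers\<close>


text \<open>The count is signed so that it is defined on all integers and its differences count
  half-open intervals, including those that straddle 0.\<close>

definition count_below :: "int set \<Rightarrow> int \<Rightarrow> int" where
  "count_below S a = int (card (S \<inter> {0..<a})) - int (card (S \<inter> {a..<0}))"

lemma count_below_Suc: "count_below S (a + 1) = count_below S a + (if a \<in> S then 1 else 0)"
proof (cases "0 \<le> a")
  case True
  have "{a..<0} = {}" "{a+1..<0} = {}" using True by auto
  moreover have "S \<inter> {0..<a+1} = (if a \<in> S then insert a (S \<inter> {0..<a}) else S \<inter> {0..<a})"
    using True by (auto simp: order_le_less)
  ultimately show ?thesis by (simp add: count_below_def)
next
  case False
  have "{0..<a} = {}" "{0..<a+1} = {}" using False by auto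
  moreover have "S \<inter> {a..<0} = (if a \<in> S then insert a (S \<inter> {a+1..<0}) else S \<inter> {a+1..<0})"
  proof -
    have "{a..<0} = insert a {a+1..<0}" using False by auto
    then show ?thesis by auto
  qed
  ultimately show ?thesis by (simp add: count_below_def)
qed

lemma count_below_diff:
  assumes "a \<le> b"
  shows "count_below S b - count_below S a = int (card (S \<inter> {a..<b}))"
  using assms
proof (induction b rule: int_ge_induct)
  case base
  then show ?case by simp
next
  case (step b)
  have "S \<inter> {a..<b+1} = (if b \<in> S then insert b (S \<inter> {a..<b}) else S \<inter> {a..<b})"
    using step.hyps by (auto simp: order_le_less)
  then show ?case using step.IH by (simp add: count_below_Suc)
qed

lemma count_below_mono: "a \<le> b \<Longrightarrow> count_below S a \<le> count_below S b"
  using count_below_diff[of a b S] by linarith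

lemma count_below_strict_mono:
  assumes "a < b" "a \<in> S"
  shows "count_below S a < count_below S b"
  using count_below_mono[of "a+1" b S] count_below_Suc[of S a] assms by simp

lemma count_below_period:
  assumes "\<And>x. x \<in> S \<longleftrightarrow> x + p \<in> S" "0 \<le> p"
  shows "count_below S (a + p) = count_below S a + int (card (S \<inter> {0..<p}))"
proof (induction a rule: int_induct[where k = 0])
  case base
  show ?case using assms(2) by (simp add: count_below_def)
next
  case (step1 i)
  have "i + 1 + p = (i + p) + 1" by simp
  then have "count_below S (i + 1 + p) = count_below S (i + p + 1)" by (rule arg_cong)
  then show ?case using step1.IH assms(1)[of i] count_below_Suc[of S "i + p"] count_below_Suc[of S i]
    by simp
next
  case (step2 i)
  have "count_below S (i + p) = count_below S (i - 1 + p) + (if i - 1 + p \<in> S then 1 else 0)"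
    using count_below_Suc[of S "i - 1 + p"] by (simp add: algebra_simps)
  moreover have "count_below S i = count_below S (i - 1) + (if i - 1 \<in> S then 1 else 0)"
    using count_below_Suc[of S "i - 1"] by simp
  ultimately show ?case using step2.IH assms(1)[of "i - 1"] by simp
qed

text \<open>Away from the multiples of \<open>m\<close> exactly one of \<open>E\<close> and
  \<open>F\<close> holds, so a step by \<open>- h\<close> swaps them; \<open>free\<close> keeps the
  intermediate points away from those multiples.\<close>

lemma alternating_chain:
  fixes E F :: "int \<Rightarrow> bool" and h m :: int
  assumes shift: "\<And>i. E i \<longleftrightarrow> F (i - h)"
    and total: "\<And>i. E i \<or> F i"
    and both: "\<And>i. \<lbrakk>E i; F i\<rbrakk> \<Longrightarrow> m dvd i"
    and start: "E 0"
    and free: "\<And>j. \<lbrakk>0 < j; j < k\<rbrakk> \<Longrightarrow> \<not> m dvd int j * h"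
  shows "0 < k \<Longrightarrow> if odd k then F (- (int k * h)) else E (- (int k * h))"
  using free
proof (induction k)
  case 0
  then show ?case by simp
next
  case (Suc k)
  have eq: "- (int (Suc k) * h) = - (int k * h) - h" by (simp add: algebra_simps)
  show ?case
  proof (cases "k = 0")
    case True
    then show ?thesis using shift[of 0] start by simp
  next
    case False
    then have IH: "if odd k then F (- (int k * h)) else E (- (int k * h))" using Suc by simp
    have nd: "\<not> m dvd - (int k * h)" using Suc.prems(2)[of k] False by simp
    show ?thesis
    proof (cases "odd k")
      case True
      then have "\<not> E (- (int k * h))" using IH nd both[of "- (int k * h)"] True by auto
      then have "E (- (int k * h) - h)" using shift total by blast
      then show ?thesis using True unfolding eq by simp
    next
      case False
      then have "F (- (int k * h) - h)" using IH shift by simp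
      then show ?thesis using False unfolding eq by simp
    qed
  qed
qed

section \<open>The strip of a periodic set\<close>

text \<open>
  \<open>\<kappa> = 0\<close> is the independent case; \<open>\<kappa> = 1\<close> is the case of the single edge \<open>{0, 3 t}\<close>, modulo \<open>n\<close>.
\<close>

locale strip =
  fixes t n r \<kappa> :: int and X :: "int set"
  assumes t2: "2 \<le> t"
    and n_def: "n = 9 * t * t - 3 * t + 1"
    and r_def: "r = 3 * t * t - 2 * t + 1"
    and kappa: "\<kappa> = 0 \<or> \<kappa> = 1"
    and period: "x \<in> X \<longleftrightarrow> x + n \<in> X"
    and card_X: "int (card (X \<inter> {0..<n})) = r"
    and sep: "\<lbrakk>x \<in> X; y \<in> X; y - x \<in> {1, 3 * t - 1, 3 * t}\<rbrakk>
               \<Longrightarrow> \<kappa> = 1 \<and> n dvd x \<and> y = x + 3 * t"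
    and defect: "\<kappa> = 1 \<Longrightarrow> 0 \<in> X \<and> 3 * t \<in> X"
begin

text \<open>
  Even elements of \<open>Q\<close> come from \<open>2 X\<close>, odd ones from \<open>2 X - s\<close>. \<open>D\<close> counts, with
  sign, the multiples of \<open>P\<close> passed between 0 and its argument, that is, the copies of the edge.
\<close>

definition s :: int where "s = 6 * t - 1"
definition P :: int where "P = 2 * n"
definition Q :: "int set" where "Q = {q. (even q \<and> q div 2 \<in> X) \<or> (odd q \<and> (q + s) div 2 \<in> X)}"
definition N :: "int \<Rightarrow> int" where "N = count_below Q"
definition D :: "int \<Rightarrow> int" where "D q = (q - 1) div P + 1"
definition J :: "int \<Rightarrow> int" where "J q = \<kappa> * D q"
definition G :: "int \<Rightarrow> int" where "G q = q - 3 * N q + 2 * J q"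

lemma t_sq: "2 * t \<le> t * t"
  using t2 by (simp add: mult_right_mono)

lemma n_gt: "6 * t + 18 < n"
proof -
  have "9 * (2 * t) \<le> 9 * (t * t)" using t_sq by linarith
  then have "9 * 2 * t - 3 * t + 1 \<le> n" unfolding n_def by (simp add: mult.assoc)
  then show ?thesis using t2 by linarith
qed

lemma P_gt: "12 * t + 36 < P"
  using n_gt unfolding P_def by linarith

lemma P_gt_24t: "24 * t - 16 \<le> P"
proof -
  define w where "w = t * t"
  have "2 * t \<le> w" using t_sq by (simp add: w_def)
  moreover have "P = 18 * w - 6 * t + 2" unfolding P_def by (subst n_def) (simp add: w_def)
  ultimately show ?thesis using t2 by linarith
qed

lemma P_eq: "P = 18 * t * t - 6 * t + 2"
  unfolding P_def by (subst n_def) simp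

lemma P_pos: "0 < P" "s < P" "0 < s" "1 < P"
  using n_gt t2 by (auto simp: P_def s_def)

lemma odd_s: "odd s"
  by (simp add: s_def)

lemma Q_even: "even q \<Longrightarrow> q \<in> Q \<longleftrightarrow> q div 2 \<in> X"
  and Q_odd: "odd q \<Longrightarrow> q \<in> Q \<longleftrightarrow> q + s \<in> Q"
  using odd_s by (auto simp: Q_def)

lemma Q_period: "q \<in> Q \<longleftrightarrow> q + P \<in> Q"
proof -
  have "(q + P) div 2 = q div 2 + n" "(q + P + s) div 2 = (q + s) div 2 + n"
    by (simp_all add: P_def)
  moreover have "even (q + P) \<longleftrightarrow> even q" by (simp add: P_def)
  ultimately show ?thesis
    using period[of "q div 2"] period[of "(q + s) div 2"] by (simp add: Q_def)
qed

lemma X_period_iter: "x \<in> X \<longleftrightarrow> x + n * k \<in> X"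
proof (induction k rule: int_induct[where k = 0])
  case base
  then show ?case by simp
next
  case (step1 i)
  then show ?case using period[of "x + n * i"] by (simp add: algebra_simps)
next
  case (step2 i)
  then show ?case using period[of "x + n * (i - 1)"] by (simp add: algebra_simps)
qed

text \<open>Each parity contributes one period of \<open>X\<close>. The odd numbers
  \<open>2 x - s\<close> fall into \<open>{0..<P}\<close> exactly for \<open>x\<close> in the
  shifted window \<open>{3 t..<3 t + n}\<close>.\<close>

lemma card_Q: "int (card (Q \<inter> {0..<P})) = 2 * r"
proof -
  have n0: "0 \<le> n" using n_gt t2 by linarith
  have "Q \<inter> {0..<P} = (\<lambda>x. 2 * x) ` (X \<inter> {0..<n}) \<union> (\<lambda>x. 2 * x - s) ` (X \<inter> {3*t..<3*t+n})"
    (is "_ = ?E \<union> ?O")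
  proof (intro Set.set_eqI iffI)
    fix q assume q: "q \<in> Q \<inter> {0..<P}"
    show "q \<in> ?E \<union> ?O"
    proof (cases "even q")
      case True
      then obtain x where "q = 2 * x" by blast
      then show ?thesis using q True by (auto simp: Q_even P_def)
    next
      case False
      then obtain x where x: "q + s = 2 * x" using odd_s by (metis dvdE even_add)
      then have "x \<in> X" using q False by (auto simp: Q_def)
      moreover have "x \<in> {3*t..<3*t+n}" using q x False by (auto simp: P_def s_def)
      moreover have "q = 2 * x - s" using x by simp
      ultimately show ?thesis by blast
    qed
  next
    fix q assume "q \<in> ?E \<union> ?O"
    then show "q \<in> Q \<inter> {0..<P}"
    proof
      assume "q \<in> ?E" then show ?thesis by (auto simp: Q_even P_def)
    next
      assume "q \<in> ?O"
      then obtain x where x: "x \<in> X" "3*t \<le> x" "x < 3*t+n" "q = 2 * x - s" by auto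
      then have "odd q" using odd_s by simp
      then show ?thesis using x by (auto simp: Q_def P_def s_def)
    qed
  qed
  moreover have "?E \<inter> ?O = {}"
  proof -
    have "even q" if "q \<in> ?E" for q using that by auto
    moreover have "odd q" if "q \<in> ?O" for q using that odd_s by auto
    ultimately show ?thesis by blast
  qed
  moreover have "finite ?E" "finite ?O" by auto
  moreover have "card ?E = card (X \<inter> {0..<n})" by (rule card_image) (auto simp: inj_on_def)
  moreover have "card ?O = card (X \<inter> {3*t..<3*t+n})" by (rule card_image) (auto simp: inj_on_def)
  moreover have "int (card (X \<inter> {3*t..<3*t+n})) = r"
    using count_below_diff[of "3*t" "3*t+n" X] count_below_period[OF period n0, of "3*t"] n0 card_X
    by simp
  ultimately show ?thesis using card_X by (simp add: card_Un_disjoint)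
qed

lemma N_period: "N (q + P) = N q + 2 * r"
  unfolding N_def using count_below_period[OF Q_period, of q] P_pos card_Q by simp

lemma D_eq:
  assumes "P * k < q" "q \<le> P * k + P"
  shows "D q = k + 1"
proof -
  have "(q - 1) div P = k"
    by (rule int_div_pos_eq[where r = "q - 1 - P * k"]) (use assms in auto)
  then show ?thesis by (simp add: D_def)
qed

lemma D_bounds: "P * (D q - 1) < q" "q \<le> P * (D q - 1) + P"
proof -
  have "P * (D q - 1) = q - 1 - (q - 1) mod P" by (simp add: D_def minus_mod_eq_mult_div)
  moreover have "0 \<le> (q - 1) mod P" "(q - 1) mod P < P" using P_pos by simp_all
  ultimately show "P * (D q - 1) < q" "q \<le> P * (D q - 1) + P" by linarith+
qed

lemma D_period: "D (q + P) = D q + 1"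
  using D_eq[of "D q" "q + P"] D_bounds[of q] by (simp add: algebra_simps)

lemma J_period: "J (q + P) = J q + \<kappa>"
  unfolding J_def D_period by (simp add: algebra_simps)

text \<open>The increment is \<open>P - 6 r = 6 t - 4\<close>, plus 2 for the one copy of the edge
  per period when \<kappa> is 1.\<close>

lemma G_period: "G (q + P) = G q + 6 * t - 4 + 2 * \<kappa>"
  unfolding G_def N_period J_period by (simp add: P_eq r_def algebra_simps)

lemma N_strict: "\<lbrakk>a \<in> Q; a < b\<rbrakk> \<Longrightarrow> N a < N b"
  unfolding N_def by (rule count_below_strict_mono)

lemma N_less_iff: "\<lbrakk>a \<in> Q; b \<in> Q\<rbrakk> \<Longrightarrow> N a < N b \<longleftrightarrow> a < b"
  using N_strict by (metis linorder_neqE_linordered_idom order_less_asym order_less_irrefl)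

lemma N_le_iff: "\<lbrakk>a \<in> Q; b \<in> Q\<rbrakk> \<Longrightarrow> N a \<le> N b \<longleftrightarrow> a \<le> b"
  using N_less_iff by (meson not_le)

lemma N_inj: "\<lbrakk>a \<in> Q; b \<in> Q; N a = N b\<rbrakk> \<Longrightarrow> a = b"
  using N_le_iff by (metis order_antisym order_refl)

text \<open>The forbidden differences become short distances in \<open>Q\<close>: 1 is distance 2
  between equal parities, \<open>3 t\<close> is distance 1 from even to odd, and
  \<open>3 t - 1\<close> is distance 1 from odd to even. The edge is an instance of the
  second.\<close>

lemma gap:
  assumes "a \<in> Q" "b \<in> Q" "a < b"
  shows "a + 3 \<le> b \<or> (\<kappa> = 1 \<and> P dvd a \<and> b = a + 1)"
proof -
  have sep': "y - x \<noteq> 1" "y - x \<noteq> 3 * t - 1" if "x \<in> X" "y \<in> X" for x y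
    using sep[OF that] t2 by auto
  show ?thesis
  proof (cases "even a"; cases "even b")
    assume e: "even a" "even b"
    then obtain x y where "a = 2 * x" "b = 2 * y" by (auto elim!: evenE)
    then show ?thesis using sep'(1)[of x y] assms e by (auto simp: Q_even)
  next
    assume e: "even a" "odd b"
    then obtain x where x: "a = 2 * x" "x \<in> X" using assms by (auto simp: Q_even elim!: evenE)
    obtain y where "b + s = 2 * y" using e odd_s by (metis dvdE even_add)
    then have y: "b = 2 * y - 6 * t + 1" "y \<in> X" using assms e by (auto simp: Q_def s_def)
    then have "y - x \<ge> 3 * t" using x assms by simp
    show ?thesis
    proof (cases "y - x = 3 * t")
      case True
      then show ?thesis using sep[OF x(2) y(2)] x y by (auto simp: P_def)
    next
      case False
      then show ?thesis using \<open>y - x \<ge> 3 * t\<close> x y by simp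
    qed
  next
    assume e: "odd a" "even b"
    then obtain x where x: "b = 2 * x" "x \<in> X" using assms by (auto simp: Q_even elim!: evenE)
    obtain y where "a + s = 2 * y" using e odd_s by (metis dvdE even_add)
    then have y: "a = 2 * y - 6 * t + 1" "y \<in> X" using assms e by (auto simp: Q_def s_def)
    then have "y - x \<le> 3 * t - 1" using x assms by linarith
    then have "y - x \<le> 3 * t - 2" using sep'(2)[OF x(2) y(2)] by linarith
    then show ?thesis using x y by simp
  next
    assume e: "odd a" "odd b"
    obtain x where "b + s = 2 * x" using e odd_s by (metis dvdE even_add)
    then have x: "b = 2 * x - 6 * t + 1" "x \<in> X" using assms e by (auto simp: Q_def s_def)
    obtain y where "a + s = 2 * y" using e odd_s by (metis dvdE even_add)
    then have y: "a = 2 * y - 6 * t + 1" "y \<in> X" using assms e by (auto simp: Q_def s_def)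
    then show ?thesis using sep'(1)[OF y(2) x(2)] x assms by simp
  qed
qed

section \<open>Neighbours in \<open>Q\<close> and the growth of \<open>G\<close> between
  them\<close>

definition adjacent_in_Q :: "int \<Rightarrow> int \<Rightarrow> bool" where
  "adjacent_in_Q a b \<longleftrightarrow> a \<in> Q \<and> b \<in> Q \<and> a < b \<and> Q \<inter> {a<..<b} = {}"

lemma adjacent_N: "adjacent_in_Q a b \<Longrightarrow> N b = N a + 1"
proof -
  assume a: "adjacent_in_Q a b"
  then have "Q \<inter> {a..<b} = {a}" by (auto simp: adjacent_in_Q_def)
  then show ?thesis using count_below_diff[of a b Q] a by (simp add: adjacent_in_Q_def N_def)
qed

lemma least_above:
  fixes S :: "int set"
  assumes "c \<in> S" "a < c"
  obtains b where "b \<in> S" "a < b" "b \<le> c" "S \<inter> {a<..<b} = {}"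
proof -
  have fin: "finite (S \<inter> {a<..c})" and ne: "S \<inter> {a<..c} \<noteq> {}" using assms by auto
  define b where "b = Min (S \<inter> {a<..c})"
  have "b \<in> S \<inter> {a<..c}" using Min_in[OF fin ne] b_def by simp
  moreover have "b \<le> x" if "x \<in> S \<inter> {a<..c}" for x using Min_le[OF fin that] b_def by simp
  ultimately show thesis using that[of b] by force
qed

lemma greatest_below:
  fixes S :: "int set"
  assumes "c \<in> S" "c < a"
  obtains b where "b \<in> S" "b < a" "c \<le> b" "S \<inter> {b<..<a} = {}"
proof -
  have fin: "finite (S \<inter> {c..<a})" and ne: "S \<inter> {c..<a} \<noteq> {}" using assms by auto
  define b where "b = Max (S \<inter> {c..<a})"
  have "b \<in> S \<inter> {c..<a}" using Max_in[OF fin ne] b_def by simp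
  moreover have "x \<le> b" if "x \<in> S \<inter> {c..<a}" for x using Max_ge[OF fin that] b_def by simp
  ultimately show thesis using that[of b] by force
qed

lemma succ_upto:
  assumes "a \<in> Q" "c \<in> Q" "a < c"
  obtains b where "adjacent_in_Q a b" "b \<le> c"
  using least_above[OF assms(2,3)] assms(1) unfolding adjacent_in_Q_def by metis

lemma pred_downto:
  assumes "a \<in> Q" "c \<in> Q" "c < a"
  obtains b where "adjacent_in_Q b a" "c \<le> b"
  using greatest_below[OF assms(2,3)] assms(1) unfolding adjacent_in_Q_def by metis

lemma Q_induct [consumes 3, case_names base step]:
  assumes "a \<in> Q" "b \<in> Q" "a \<le> b"
    and base: "R a"
    and step: "\<And>q q'. \<lbrakk>adjacent_in_Q q q'; a \<le> q; q' \<le> b; R q\<rbrakk> \<Longrightarrow> R q'"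
  shows "R b"
proof -
  have "\<forall>c. c \<in> Q \<longrightarrow> a \<le> c \<longrightarrow> c \<le> b \<longrightarrow> k = nat (N c - N a) \<longrightarrow> R c" for k
  proof (induction k)
    case 0
    have "c = a" if "c \<in> Q" "a \<le> c" "0 = nat (N c - N a)" for c
      using that assms(1) N_strict[of a c] by (cases "a = c") auto
    then show ?case using base by blast
  next
    case (Suc k)
    show ?case
    proof (intro allI impI)
      fix c assume c: "c \<in> Q" "a \<le> c" "c \<le> b" "Suc k = nat (N c - N a)"
      then have "a < c" by (cases "a = c") auto
      then obtain p where p: "adjacent_in_Q p c" "a \<le> p" using pred_downto[OF c(1) assms(1)] by blast
      then have "N c = N p + 1" using adjacent_N by blast
      then have "k = nat (N p - N a)" using c(4) by simp
      then have "R p" using Suc.IH p c by (auto simp: adjacent_in_Q_def)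
      then show "R c" using step[OF p(1) p(2) c(3)] by blast
    qed
  qed
  then show ?thesis using assms by blast
qed

lemma one_in_Q: "\<kappa> = 1 \<Longrightarrow> 0 \<in> Q \<and> 1 \<in> Q"
  using defect by (simp add: Q_def s_def)

lemma Q_period_iter: "q \<in> Q \<longleftrightarrow> q + P * k \<in> Q"
proof (induction k rule: int_induct[where k = 0])
  case base
  then show ?case by simp
next
  case (step1 i)
  then show ?case using Q_period[of "q + P * i"] by (simp add: algebra_simps)
next
  case (step2 i)
  then show ?case using Q_period[of "q + P * (i - 1)"] by (simp add: algebra_simps)
qed

text \<open>\<open>N\<close> rises by 1 between neighbours, so \<open>G\<close> rises by the gap
  minus 3. At the edge, with gap 1, the resulting \<open>-2\<close> is cancelled by the term
  \<open>2 * J q\<close> in \<open>G\<close>.\<close>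

lemma adjacent_step:
  assumes "adjacent_in_Q a b"
  shows "(a + 3 \<le> b \<and> G b = G a + (b - a) - 3 \<and> J b = J a)
    \<or> (\<kappa> = 1 \<and> P dvd a \<and> b = a + 1 \<and> G b = G a \<and> D b = D a + 1)"
proof -
  have ab: "a \<in> Q" "b \<in> Q" "a < b" using assms by (auto simp: adjacent_in_Q_def)
  have Gb: "G b = G a + (b - a) - 3 + 2 * (J b - J a)"
    by (simp add: G_def adjacent_N[OF assms] algebra_simps)
  show ?thesis
  proof (cases "\<kappa> = 1 \<and> P dvd a \<and> b = a + 1")
    case True
    then obtain k where k: "a = P * k" by blast
    have "D a = k" "D b = k + 1"
      using D_eq[of "k - 1" a] D_eq[of k b] True k P_pos by (simp_all add: algebra_simps)
    moreover from this True have "J b - J a = 1" unfolding J_def by simp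
    moreover have T: "\<kappa> = 1" "P dvd a" "b = a + 1" using True by auto
    ultimately have "G b = G a" "D b = D a + 1" using Gb T(3) by simp_all
    then show ?thesis using T by blast
  next
    case False
    then have g: "a + 3 \<le> b" using gap[OF ab] by blast
    have "J b = J a"
    proof (cases "\<kappa> = 1")
      case True
      define k where "k = D b - 1"
      have kb: "P * k < b" "b \<le> P * k + P" using D_bounds[of b] by (simp_all add: k_def)
      \<comment> \<open>Both ends of the last copy of the edge starting before \<open>b\<close> lie
        in \<open>Q\<close>, hence not strictly between the neighbours. So \<open>a\<close> is
        already beyond \<open>P * k\<close>, and \<open>D\<close> does not change.\<close>
      have "P * k \<in> Q" "P * k + 1 \<in> Q"
        using one_in_Q[OF True] Q_period_iter[of 0 k] Q_period_iter[of 1 k] by (auto simp: add.commute)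
      then have "P * k \<notin> {a<..<b}" "P * k + 1 \<notin> {a<..<b}"
        using assms unfolding adjacent_in_Q_def by auto
      then have "P * k < a" using kb g by auto
      then show ?thesis using D_eq[of k a] kb ab unfolding J_def by (simp add: k_def)
    next
      case False
      then show ?thesis using kappa unfolding J_def by simp
    qed
    then show ?thesis using g Gb by simp
  qed
qed

lemma adjacent_G_mono: "adjacent_in_Q a b \<Longrightarrow> G a \<le> G b"
  using adjacent_step[of a b] by linarith

lemma adjacent_same_parity:
  assumes "adjacent_in_Q a b" "even a \<longleftrightarrow> even b"
  shows "G a + 1 \<le> G b" "a + 4 \<le> b"
proof -
  have "b \<noteq> a + 1" "b \<noteq> a + 3" using assms(2) by auto
  then show "G a + 1 \<le> G b" "a + 4 \<le> b" using adjacent_step[OF assms(1)] by auto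
qed

lemma G_mono: "\<lbrakk>a \<in> Q; b \<in> Q; a \<le> b\<rbrakk> \<Longrightarrow> G a \<le> G b"
proof (induction rule: Q_induct)
  case base
  show ?case by simp
next
  case (step q q')
  then show ?case using adjacent_G_mono[of q q'] by linarith
qed

section \<open>Loops from \<open>B\<close> to \<open>B + s\<close>, and connectors to the next odd
  element\<close>

lemma loop_end: "\<lbrakk>B \<in> Q; odd B\<rbrakk> \<Longrightarrow> B + s \<in> Q \<and> even (B + s)"
  using Q_odd[of B] odd_s by simp

lemma loop_start: "\<lbrakk>A \<in> Q; even A\<rbrakk> \<Longrightarrow> A - s \<in> Q \<and> odd (A - s)"
  using Q_odd[of "A - s"] odd_s by simp

lemma G_diff: "G b - G a = (b - a) - 3 * (N b - N a) + 2 * (J b - J a)"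
  by (simp add: G_def algebra_simps)

text \<open>\<open>B\<close> and \<open>B + s\<close> come from the same element of
  \<open>X\<close>. As \<open>s = 6 t - 1\<close>, the growth of \<open>G\<close> is 2 modulo 3, and
  monotonicity excludes negative values. Each further 3 of growth means one element of
  \<open>Q\<close> fewer on the way.\<close>

lemma loop_G:
  assumes "B \<in> Q" "odd B" "J (B + s) = J B"
  obtains z where "0 \<le> z" "G (B + s) = G B + 2 + 3 * z" "N (B + s) - N B = 2 * t - 1 - z"
proof -
  define m where "m = N (B + s) - N B"
  define z where "z = 2 * t - 1 - m"
  have "G (B + s) - G B = s - 3 * m"
    using G_diff[of "B + s" B] assms(3) by (simp add: m_def)
  moreover have "s = 6 * t - 1" by (rule s_def)
  ultimately have "G (B + s) = G B + 2 + 3 * z" unfolding z_def by simp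
  moreover have "G B \<le> G (B + s)"
    using G_mono[of B "B + s"] loop_end[OF assms(1,2)] assms(1) P_pos by simp
  ultimately have "0 \<le> z" by linarith
  moreover have "N (B + s) - N B = 2 * t - 1 - z" by (simp add: z_def m_def)
  ultimately show thesis using \<open>G (B + s) = G B + 2 + 3 * z\<close> by (intro that)
qed

lemma even_run:
  assumes "a \<in> Q" "b \<in> Q" "a \<le> b" "\<And>q. \<lbrakk>q \<in> Q; a \<le> q; q \<le> b\<rbrakk> \<Longrightarrow> even q"
  shows "N b - N a \<le> G b - G a"
  using assms(1-3)
proof (induction rule: Q_induct)
  case base
  then show ?case by simp
next
  case (step q q')
  have "q \<in> Q" "q' \<in> Q" "q < q'" using step.hyps(1) by (auto simp: adjacent_in_Q_def)
  then have "even q" "even q'" using assms(4) step.hyps by auto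
  then show ?case using adjacent_same_parity[OF step.hyps(1)] adjacent_N[OF step.hyps(1)] step.IH
    by simp
qed

definition is_next_odd :: "int \<Rightarrow> int \<Rightarrow> bool" where
  "is_next_odd A B \<longleftrightarrow> B \<in> Q \<and> odd B \<and> A < B \<and> (\<forall>q\<in>Q. A < q \<longrightarrow> q < B \<longrightarrow> even q)"

lemma next_odd_exists:
  assumes "A \<in> Q" "even A"
  obtains B where "is_next_odd A B"
proof -
  \<comment> \<open>One period later the odd partner \<open>A - s\<close> lies beyond
    \<open>A\<close>, because \<open>s < P\<close>.\<close>
  have 1: "A - s + P \<in> {q \<in> Q. odd q}"
    using loop_start[OF assms] Q_period[of "A - s"] by (simp add: P_def)
  have 2: "A < A - s + P" using P_pos by simp
  obtain B where B: "B \<in> {q \<in> Q. odd q}" "A < B" "{q \<in> Q. odd q} \<inter> {A<..<B} = {}"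
    by (rule least_above[OF 1 2])
  have "even q" if "q \<in> Q" "A < q" "q < B" for q
  proof (rule ccontr)
    assume "odd q"
    then have "q \<in> {q \<in> Q. odd q} \<inter> {A<..<B}" using that by simp
    then show False using B(3) by simp
  qed
  then have "is_next_odd A B" using B(1,2) unfolding is_next_odd_def by simp
  then show thesis by (rule that)
qed

lemma last_even_before:
  assumes "A \<in> Q" "even A" "is_next_odd A B"
  obtains p where "adjacent_in_Q p B" "A \<le> p" "even p" "\<And>q. \<lbrakk>q \<in> Q; A \<le> q; q \<le> p\<rbrakk> \<Longrightarrow> even q"
proof -
  obtain p where p: "adjacent_in_Q p B" "A \<le> p"
    using pred_downto[of B A] assms by (auto simp: is_next_odd_def)
  have "even q" if "q \<in> Q" "A \<le> q" "q \<le> p" for q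
  proof (cases "q = A")
    case False
    then show ?thesis using that p assms unfolding is_next_odd_def adjacent_in_Q_def by force
  qed (use assms in simp)
  then show thesis using that p by (auto simp: adjacent_in_Q_def)
qed

text \<open>\<open>N B - N A - 1\<close> counts the even elements after \<open>A\<close> and before
  \<open>B\<close>. Each adds at least 1 to \<open>G\<close>, and the last step, from even to odd,
  does not decrease it.\<close>

lemma connector:
  assumes "A \<in> Q" "even A" "is_next_odd A B"
  shows "0 \<le> N B - N A - 1" "N B - N A - 1 \<le> G B - G A"
proof -
  obtain p where p: "adjacent_in_Q p B" "A \<le> p" "even p" "\<And>q. \<lbrakk>q \<in> Q; A \<le> q; q \<le> p\<rbrakk> \<Longrightarrow> even q"
    using last_even_before[OF assms] by metis
  have pQ: "p \<in> Q" using p by (auto simp: adjacent_in_Q_def)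
  have "N p - N A \<le> G p - G A" using even_run[OF assms(1) pQ p(2)] p(4) by blast
  then show "0 \<le> N B - N A - 1" "N B - N A - 1 \<le> G B - G A"
    using adjacent_N[OF p(1)] adjacent_G_mono[OF p(1)] N_le_iff[OF assms(1) pQ] p(2) by auto
qed

lemma G_period_iter: "G (q + P * k) = G q + (6 * t - 4 + 2 * \<kappa>) * k"
proof (induction k rule: int_induct[where k = 0])
  case base
  then show ?case by simp
next
  case (step1 i)
  then show ?case using G_period[of "q + P * i"] by (simp add: algebra_simps)
next
  case (step2 i)
  then show ?case using G_period[of "q + P * (i - 1)"] by (simp add: algebra_simps)
qed

lemma N_period_iter: "N (q + P * k) = N q + 2 * r * k"
proof (induction k rule: int_induct[where k = 0])
  case base
  then show ?case by simp
next
  case (step1 i)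
  then show ?case using N_period[of "q + P * i"] by (simp add: algebra_simps)
next
  case (step2 i)
  then show ?case using N_period[of "q + P * (i - 1)"] by (simp add: algebra_simps)
qed

lemma r_pos: "9 \<le> r"
proof -
  have "0 \<le> (t - 2) * (3 * t + 4)" using t2 by simp
  then show ?thesis unfolding r_def by (simp add: algebra_simps)
qed

section \<open>There is no independent set of size r\<close>

text \<open>
  \<open>\<Phi>\<close> is periodic, so it has a maximum on the odd elements of \<open>Q\<close>, but it increases along the path.
\<close>

lemma kappa_nonzero: "\<kappa> \<noteq> 0"
proof
  assume "\<kappa> = 0"
  then have k0: "J a = 0" and k0': "\<kappa> * a = 0" for a unfolding J_def by simp_all
  \<comment> \<open>Subtracting the mean slope \<open>(6 t - 4) / P\<close> from \<open>G\<close>,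
    scaled by \<open>P\<close>, makes the function periodic.\<close>
  define \<Phi> where "\<Phi> B = P * G B - (6 * t - 4) * B" for B
  have \<Phi>_period: "\<Phi> (B + P * k) = \<Phi> B" for B k
  proof -
    have "(6 * t - 4 + 2 * \<kappa>) * k = (6 * t - 4) * k" by (simp add: algebra_simps k0')
    then have "G (B + P * k) = G B + (6 * t - 4) * k" using G_period_iter[of B k] by simp
    then show ?thesis unfolding \<Phi>_def by (simp only:) (simp add: algebra_simps)
  qed
  define S where "S = {q \<in> Q. odd q \<and> 0 \<le> q \<and> q < P}"
  have fin: "finite S" unfolding S_def by (rule finite_subset[of _ "{0..<P}"]) auto
  have red: "B - P * (B div P) \<in> S" if "B \<in> Q" "odd B" for B
  proof -
    have "B - P * (B div P) \<in> Q" using Q_period_iter[of B "- (B div P)"] that by simp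
    moreover have "B - P * (B div P) = B mod P" by (simp add: minus_mult_div_eq_mod)
    moreover have "odd (B - P * (B div P))" using that by (simp add: P_def)
    ultimately show ?thesis using P_pos by (simp add: S_def)
  qed
  have "X \<inter> {0..<n} \<noteq> {}" using card_X r_pos by auto
  then obtain x where "x \<in> X" by blast
  then have "2 * x \<in> Q" by (simp add: Q_even)
  then have "2 * x - s \<in> Q" "odd (2 * x - s)" using loop_start[of "2 * x"] by auto
  then have ne: "S \<noteq> {}" using red by blast
  then have "Max (\<Phi> ` S) \<in> \<Phi> ` S" using fin by (intro Max_in) auto
  then obtain B where B: "B \<in> S" "\<Phi> B = Max (\<Phi> ` S)" by auto
  have max: "\<Phi> y \<le> \<Phi> B" if "y \<in> S" for y
    unfolding B(2) using fin that by (intro Max_ge) auto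
  have BQ: "B \<in> Q" "odd B" using B by (auto simp: S_def)
  obtain z where z: "0 \<le> z" "G (B + s) = G B + 2 + 3 * z"
    using loop_G[OF BQ] by (auto simp: k0)
  have A: "B + s \<in> Q" "even (B + s)" using loop_end[OF BQ] by auto
  obtain B' where B': "is_next_odd (B + s) B'" using next_odd_exists[OF A] .
  define I c where "I = N B' - N (B + s) - 1" and "c = G B' - G (B + s)"
  have Ic: "0 \<le> I" "I \<le> c" using connector[OF A B'] by (auto simp: I_def c_def)
  have time: "B' = B + s + 3 * (I + 1) + c"
    using G_diff[of B' "B + s"] by (simp add: I_def c_def k0)
  have "B' \<in> Q" "odd B'" using B' by (auto simp: is_next_odd_def)
  then have "\<Phi> (B' - P * (B' div P)) \<le> \<Phi> B" using red max by blast
  then have "\<Phi> B' \<le> \<Phi> B" using \<Phi>_period[of B' "- (B' div P)"] by simp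
  moreover have "\<Phi> B' - \<Phi> B = P * (2 + 3 * z + c) - (6 * t - 4) * (6 * t + 2 + 3 * I + c)"
  proof -
    have "G B' = G B + 2 + 3 * z + c" using z by (simp add: c_def)
    then show ?thesis by (simp add: \<Phi>_def time s_def algebra_simps)
  qed
  \<comment> \<open>The constant is \<open>2 P - (6 t - 4) (6 t + 2) = 12\<close>. Since
    \<open>I \<le> c\<close> and \<open>4 (6 t - 4) \<le> P\<close>, the term in \<open>c\<close>
    absorbs the negative one.\<close>
  moreover have "\<dots> = 12 + 3 * (z * P) + c * (P - (6 * t - 4)) - 3 * (I * (6 * t - 4))"
    by (simp add: P_eq algebra_simps)
  moreover have "0 \<le> z * P" using z P_pos by simp
  moreover have "I * (6 * t - 4) \<le> c * (6 * t - 4)" using Ic t2 by (intro mult_right_mono) auto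
  moreover have "c * (4 * (6 * t - 4)) \<le> c * P"
  proof (rule mult_left_mono)
    show "4 * (6 * t - 4) \<le> P" using P_gt_24t by simp
  qed (use Ic in simp)
  ultimately show False by (simp add: algebra_simps)
qed

section \<open>The path starting at the edge\<close>

lemma kappa_1: "\<kappa> = 1"
  using kappa kappa_nonzero by simp

lemma zero_one_Q: "0 \<in> Q" "1 \<in> Q"
  using one_in_Q kappa_1 by auto

lemma J_eq_D: "J q = D q"
  by (metis J_def kappa_1 mult_1)

lemma D_1: "\<lbrakk>1 \<le> q; q \<le> P\<rbrakk> \<Longrightarrow> D q = 1"
  using D_eq[of 0 q] by simp

lemma D_0: "\<lbrakk>- P < q; q \<le> 0\<rbrakk> \<Longrightarrow> D q = 0"
  using D_eq[of "- 1" q] by simp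

lemma N_0: "N 0 = 0"
  by (simp add: N_def count_below_def)

lemma N_1: "N 1 = 1"
  using count_below_Suc[of Q 0] N_0 zero_one_Q by (simp add: N_def)

lemma N_P: "N P = 2 * r"
  using N_period[of 0] N_0 by simp

lemma G_0: "G 0 = 0"
  using P_pos D_0[of 0] by (simp add: G_def N_0 J_eq_D)

lemma G_1: "G 1 = 0"
  using P_pos D_1[of 1] by (simp add: G_def N_1 J_eq_D)

lemma G_shift: "G (q + P) = G q + 6 * t - 2"
  using G_period[of q] kappa_1 by linarith

lemma G_P: "G P = 6 * t - 2" "G (P + 1) = 6 * t - 2"
  using G_shift[of 0] G_shift[of 1] G_0 G_1 by (simp_all add: add.commute[of P])

lemma P_Q: "P \<in> Q" "P + 1 \<in> Q" "even P"
  using Q_period[of 0] Q_period[of 1] zero_one_Q by (simp_all add: add.commute[of P], simp add: P_def)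

lemma no_defect_inside: "\<lbrakk>1 \<le> a; a < P\<rbrakk> \<Longrightarrow> \<not> P dvd a"
  using zdvd_not_zless[of a P] by simp

lemma gap_odd: "\<lbrakk>a \<in> Q; b \<in> Q; a < b; odd a\<rbrakk> \<Longrightarrow> a + 3 \<le> b"
  using gap[of a b] P_Q(3) dvd_trans[of 2 P a] by blast

lemma gap_same_parity:
  assumes "a \<in> Q" "b \<in> Q" "a < b" "even a \<longleftrightarrow> even b"
  shows "a + 4 \<le> b"
proof -
  have "b \<noteq> a + 1" "b \<noteq> a + 3" using assms(4) by auto
  then show ?thesis using gap[OF assms(1-3)] by linarith
qed

text \<open>Where \<open>G\<close> is constant, every step has length exactly 3 and flips the
  parity, so equal parities at the ends force at least two steps.\<close>

lemma zero_run_right: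
  assumes "a \<in> Q" "b \<in> Q" "1 \<le> a" "a < b" "b \<le> P" "even a \<longleftrightarrow> even b" "G a = G b"
  shows "a + 6 \<in> Q"
proof -
  have step: "a + 3 \<in> Q \<and> G (a + 3) = G b"
    if h: "a \<in> Q" "1 \<le> a" "a < b" "G a = G b" for a
  proof -
    obtain c where c: "adjacent_in_Q a c" "c \<le> b" using succ_upto[OF h(1) assms(2) h(3)] .
    have cQ: "c \<in> Q" using c by (simp add: adjacent_in_Q_def)
    have "G c = G a" using G_mono[OF cQ assms(2) c(2)] adjacent_G_mono[OF c(1)] h(4) by (intro antisym; linarith)
    moreover have "\<not> P dvd a" using no_defect_inside h assms by simp
    ultimately have "c = a + 3" using adjacent_step[OF c(1)] by auto
    then show ?thesis using cQ \<open>G c = G a\<close> h by simp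
  qed
  have 1: "a + 3 \<in> Q" "G (a + 3) = G b" using step[of a] assms by auto
  have "a + 3 \<noteq> b" using assms(6) by auto
  moreover have "a + 3 \<le> b" using gap_same_parity[OF assms(1,2,4,6)] by linarith
  ultimately show ?thesis using step[of "a + 3"] 1 assms(3) by (simp add: add.commute)
qed

lemma zero_run_left:
  assumes "a \<in> Q" "b \<in> Q" "1 \<le> a" "a < b" "b \<le> P" "even a \<longleftrightarrow> even b" "G a = G b"
  shows "b - 6 \<in> Q"
proof -
  have step: "b - 3 \<in> Q \<and> G (b - 3) = G a"
    if h: "b \<in> Q" "b \<le> P" "a < b" "G a = G b" for b
  proof -
    obtain c where c: "adjacent_in_Q c b" "a \<le> c" using pred_downto[OF h(1) assms(1) h(3)] .
    have cQ: "c \<in> Q" "c < b" using c by (simp_all add: adjacent_in_Q_def)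
    have "G c = G b" using G_mono[OF assms(1) cQ(1) c(2)] adjacent_G_mono[OF c(1)] h(4) by (intro antisym; linarith)
    moreover have "\<not> P dvd c" using no_defect_inside[of c] h assms cQ c by simp
    ultimately have "c = b - 3" using adjacent_step[OF c(1)] by auto
    then show ?thesis using cQ \<open>G c = G b\<close> h by simp
  qed
  have 1: "b - 3 \<in> Q" "G (b - 3) = G a" using step[of b] assms by auto
  have "b - 3 \<noteq> a" using assms(6) by auto
  moreover have "a \<le> b - 3" using gap_same_parity[OF assms(1,2,4,6)] by linarith
  ultimately show ?thesis using step[of "b - 3"] 1 assms(5) by simp
qed

lemma loop_inside:
  assumes "B \<in> Q" "odd B" "1 \<le> B" "B + s \<le> P"
  obtains z where "0 \<le> z" "G (B + s) = G B + 2 + 3 * z" "N (B + s) - N B = 2 * t - 1 - z"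
proof -
  have "J (B + s) = J B" using assms P_pos D_1[of B] D_1[of "B + s"] by (simp add: J_eq_D)
  then show thesis using loop_G[OF assms(1,2)] that by blast
qed

section \<open>The path from 1 through one period\<close>

definition next_odd :: "int \<Rightarrow> int" where
  "next_odd A = (SOME B. is_next_odd A B)"

definition path :: "nat \<Rightarrow> int" where
  "path l = ((\<lambda>B. next_odd (B + s)) ^^ l) 1"

lemma next_odd:
  assumes "A \<in> Q" "even A"
  shows "is_next_odd A (next_odd A)"
proof -
  obtain B where "is_next_odd A B" using next_odd_exists[OF assms] .
  then show ?thesis unfolding next_odd_def by (rule someI)
qed

lemma path_0: "path 0 = 1"
  by (simp add: path_def)

lemma path_Suc: "path (Suc l) = next_odd (path l + s)"
  by (simp add: path_def)

lemma path_Q: "path l \<in> Q \<and> odd (path l)"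
proof (induction l)
  case 0
  then show ?case using zero_one_Q by (simp add: path_0)
next
  case (Suc l)
  then show ?case using next_odd[of "path l + s"] loop_end[of "path l"]
    by (simp add: path_Suc is_next_odd_def)
qed

lemma path_next: "is_next_odd (path l + s) (path (Suc l))"
  using next_odd[of "path l + s"] loop_end[of "path l"] path_Q by (simp add: path_Suc)

lemma path_step_less: "path l + s < path (Suc l)"
  using path_next[of l] by (simp add: is_next_odd_def)

lemma path_mono: "l \<le> m \<Longrightarrow> path l \<le> path m"
proof (rule lift_Suc_mono_le[of path])
  show "path k \<le> path (Suc k)" for k using path_step_less[of k] P_pos by simp
qed

lemma path_ge: "1 + int l \<le> path l"
proof (induction l)
  case 0
  then show ?case by (simp add: path_0)
next
  case (Suc l)
  then show ?case using path_step_less[of l] P_pos by simp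
qed

definition path_length :: nat where "path_length = (LEAST l. P < path l + s)"

lemma path_length_props: "P < path path_length + s" "i < path_length \<Longrightarrow> path i + s \<le> P"
proof -
  have "P < path (nat P) + s" using path_ge[of "nat P"] P_pos by simp
  then show "P < path path_length + s" unfolding path_length_def by (rule LeastI)
  show "i < path_length \<Longrightarrow> path i + s \<le> P" unfolding path_length_def using not_less_Least by fastforce
qed

text \<open>A loop raises \<open>G\<close> by at least 2. The growth beyond that, together with the
  growth on connectors, has to fit into the total \<open>6 t - 2\<close> of one period.\<close>

definition loop_excess :: "nat \<Rightarrow> int" where "loop_excess i = G (path i + s) - G (path i) - 2"
definition extra_evens :: "nat \<Rightarrow> int" where "extra_evens i = N (path (Suc i)) - N (path i + s) - 1"
definition connector_excess :: "nat \<Rightarrow> int" where "connector_excess i = G (path (Suc i)) - G (path i + s)"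

lemma path_pos: "1 \<le> path i"
  using path_ge[of i] by simp

lemma loop_excess_props:
  assumes "i < path_length"
  shows "0 \<le> loop_excess i" "3 dvd loop_excess i"
proof -
  obtain z where "0 \<le> z" "G (path i + s) = G (path i) + 2 + 3 * z"
    using loop_inside[of "path i"] path_Q[of i] path_pos[of i] path_length_props(2)[OF assms] by metis
  then show "0 \<le> loop_excess i" "3 dvd loop_excess i" by (simp_all add: loop_excess_def)
qed

lemma extra_evens_le: "0 \<le> extra_evens i" "extra_evens i \<le> connector_excess i"
  using connector[of "path i + s" "path (Suc i)"] loop_end[of "path i"] path_Q[of i] path_next[of i]
  by (simp_all add: extra_evens_def connector_excess_def)

lemma path_le_P: "i < path_length \<Longrightarrow> path (Suc i) \<le> P + 1"
proof -
  assume "i < path_length"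
  then have "path i + s < P + 1" using path_length_props by fastforce
  moreover have "odd (P + 1)" using P_Q by simp
  ultimately show ?thesis using path_next[of i] P_Q(2) unfolding is_next_odd_def by force
qed

text \<open>This is \<open>G_diff\<close> solved for the distance: the loop has length
  \<open>6 t - 1\<close>, and the connector adds 3 for each of its \<open>extra_evens i + 1\<close>
  gaps plus its growth of \<open>G\<close>. The \<open>D\<close> term is nonzero only for a step
  that lands on \<open>P + 1\<close>.\<close>

lemma time_step:
  assumes "i < path_length"
  shows "path (Suc i) = path i + 6 * t + 2 + 3 * extra_evens i + connector_excess i - 2 * (D (path (Suc i)) - 1)"
proof -
  have "D (path i + s) = 1"
    using D_1[of "path i + s"] path_length_props(2)[OF assms] path_pos[of i] P_pos by simp
  then show ?thesis
    using G_diff[of "path (Suc i)" "path i + s"] s_def unfolding extra_evens_def connector_excess_def J_eq_D by (smt (verit))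
qed

lemma path_length_pos: "0 < path_length"
proof (rule ccontr)
  assume "\<not> 0 < path_length"
  then have "P < 1 + s" using path_length_props(1) by (simp add: path_0)
  then show False using P_gt s_def t2 by linarith
qed

lemma path_sums:
  "l \<le> path_length \<Longrightarrow> G (path l) = 2 * int l + (\<Sum>i<l. loop_excess i) + (\<Sum>i<l. connector_excess i)
     \<and> path l = 1 + (6 * t + 2) * int l + 3 * (\<Sum>i<l. extra_evens i) + (\<Sum>i<l. connector_excess i) - 2 * (D (path l) - 1)"
proof (induction l)
  case 0
  then show ?case using P_pos by (simp add: path_0 G_1 D_1)
next
  case (Suc l)
  have "D (path l) = 1"
    using D_1[of "path l"] path_pos[of l] path_length_props(2)[of l] Suc.prems P_pos by simp
  moreover have "G (path (Suc l)) = G (path l) + 2 + loop_excess l + connector_excess l" by (simp add: loop_excess_def connector_excess_def)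
  ultimately show ?case using Suc time_step[of l] by (simp add: algebra_simps)
qed

lemma P_minus_s: "P - s \<in> Q" "odd (P - s)" "1 \<le> P - s"
  using loop_start[OF P_Q(1,3)] P_gt s_def t2 by auto

lemma parity_of_step:
  fixes x y a c d :: int
  shows "\<lbrakk>odd x; odd y; x = y + 6 * t + 2 + 3 * a + c - 2 * d\<rbrakk> \<Longrightarrow> even (c - a)"
  by presburger

text \<open>
  With \<open>q = 3 t - 2 - path_length\<close>, the growth of \<open>G\<close> on one period bounds \<open>Z + C\<close> by \<open>2 q + 2\<close>, while
  the end point of the path determines \<open>C + 3 I\<close>; only \<open>q \<in> {0, 1}\<close> survives. The exceptional second
  alternative is a path with exactly one connector of length 5 instead of 3.
\<close>

lemma path_budget:
  assumes "i < path_length"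
  shows "loop_excess i = 0"
    and "connector_excess i = extra_evens i \<or> connector_excess i = 2 \<and> extra_evens i = 0 \<and> 6 * t - 2 - 2 * int path_length = (\<Sum>i<path_length. connector_excess i)"
    and "6 * t - 2 * int path_length - (\<Sum>i<path_length. connector_excess i) \<le> 4"
proof -
  define Z I C where "Z = (\<Sum>i<path_length. loop_excess i)" and "I = (\<Sum>i<path_length. extra_evens i)" and "C = (\<Sum>i<path_length. connector_excess i)"
  define q where "q = 3 * t - 2 - int path_length"
  define e where "e = D (path path_length) - 1"
  have Z: "0 \<le> Z" "3 dvd Z" using loop_excess_props by (auto simp: Z_def intro!: sum_nonneg dvd_sum)
  have I: "0 \<le> I" "I \<le> C" using extra_evens_le by (auto simp: I_def C_def intro!: sum_nonneg sum_mono)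
  have par: "even (connector_excess i - extra_evens i)" if "i < path_length" for i
  proof -
    have "odd (path (Suc i))" "odd (path i)" using path_Q by auto
    then show ?thesis using time_step[OF that] by (rule parity_of_step)
  qed
  have CI: "even (C - I)" using par unfolding C_def I_def sum_subtractf[symmetric]
    by (intro dvd_sum) auto
  obtain L' where L': "path_length = Suc L'" using path_length_pos gr0_implies_Suc by blast
  have le: "path path_length \<le> P + 1" using path_le_P[of L'] L' by simp
  have pQ: "path path_length \<in> Q" "odd (path path_length)" using path_Q by auto
  have "G (path path_length) \<le> 6 * t - 2" using G_mono[OF pQ(1) P_Q(2) le] G_P by simp
  then have bud: "Z + C \<le> 2 * q + 2"
    using path_sums[of path_length] by (simp add: Z_def C_def q_def)
  have "path path_length = 1 + (6 * t + 2) * int path_length + 3 * I + C - 2 * e"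
    using path_sums[of path_length] by (simp add: I_def C_def e_def)
  moreover have "(6 * t + 2) * int path_length = P - 6 - (6 * t + 2) * q"
    by (simp add: q_def P_eq algebra_simps)
  ultimately have time: "C + 3 * I = (6 * t + 2) * q + 5 + (path path_length - P) + 2 * e" by simp
  \<comment> \<open>The path ends either on \<open>P + 1\<close>, the translate of its start, or
    strictly between \<open>P - s\<close> and \<open>P\<close>. In the second case the gaps in
    \<open>Q\<close> sharpen both bounds.\<close>
  have cases: "(e = 0 \<and> path path_length \<le> P - 3 \<and> P - s + 4 \<le> path path_length) \<or> (e = 1 \<and> path path_length = P + 1)"
  proof (cases "path path_length = P + 1")
    case True
    then have "D (path path_length) = 2" using D_eq[of 1 "path path_length"] P_pos by simp
    then show ?thesis using True by (simp add: e_def)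
  next
    case False
    moreover have "path path_length \<noteq> P" using pQ P_Q by auto
    ultimately have lt: "path path_length < P" using le by simp
    then have "path path_length + 3 \<le> P" using gap_odd[OF pQ(1) P_Q(1)] pQ by blast
    moreover have "P - s < path path_length" using path_length_props(1) by simp
    then have "P - s + 4 \<le> path path_length" using gap_same_parity[OF P_minus_s(1) pQ(1)] P_minus_s pQ by blast
    moreover have "e = 0" using D_1[of "path path_length"] lt path_pos by (simp add: e_def)
    ultimately show ?thesis by simp
  qed
  define F where "F = (6 * t + 2) * q"
  have lower: "(6 * t + 2) * (q - 1) + 12 \<le> C + 3 * I"
  proof -
    have "(6 * t + 2) * (q - 1) = F - 6 * t - 2" by (simp add: F_def algebra_simps)
    then show ?thesis using time cases t2 s_def unfolding F_def[symmetric] by linarith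
  qed
  have "q \<le> 1"
  proof (rule ccontr)
    assume "\<not> q \<le> 1"
    \<comment> \<open>Against this lower bound stands
      \<open>C + 3 I \<le> 4 C \<le> 8 q + 8\<close>, which is too small once \<open>q\<close> is at
      least 2.\<close>
    then have "14 * (q - 1) \<le> (6 * t + 2) * (q - 1)" using t2 by (intro mult_right_mono) auto
    then have "14 * (q - 1) + 12 \<le> C + 3 * I" using lower by (meson add_right_mono order_trans)
    then have "14 * q - 2 \<le> C + 3 * I" by simp
    then show False using bud I Z(1) \<open>\<not> q \<le> 1\<close> by linarith
  qed
  moreover have "-1 \<le> q" using bud Z I by linarith
  ultimately have "q = -1 \<or> q = 0 \<or> q = 1" by linarith
  then have main: "Z = 0 \<and> (C = I \<or> C = 2 \<and> I = 0 \<and> q = 0) \<and> 4 + 2 * q - C \<le> 4"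
  proof (elim disjE)
    assume q: "q = -1"
    then have "C = 0" "I = 0" using bud Z I by auto
    then show ?thesis using time cases q t2 s_def by auto
  next
    assume q: "q = 0"
    then have C: "C \<le> 2" and Z0: "Z \<le> 2" using bud Z I by auto
    have "Z = 0" using Z Z0 by presburger
    moreover have "C = I \<or> C = 2 \<and> I = 0"
    proof -
      define w where "w = path path_length - P"
      have "C + 3 * I = 5 + w + 2 * e" using time q by (simp add: w_def)
      moreover have "e = 0 \<and> w \<le> -3 \<or> e = 1 \<and> w = 1" using cases by (auto simp: w_def)
      ultimately show ?thesis using C I CI by presburger
    qed
    ultimately show ?thesis using q I by auto
  next
    assume q: "q = 1"
    then have C: "C \<le> 4" using bud Z by auto
    \<comment> \<open>With \<open>I \<le> C \<le> 4\<close> and \<open>C - I\<close> even, this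
      leaves only \<open>C = I = 3\<close> and \<open>C = I = 4\<close>.\<close>
    have low: "12 \<le> C + 3 * I" using lower q by simp
    then have "C = I" using C I CI by presburger
    moreover have "3 \<le> C" using low I by linarith
    moreover have "Z = 0" using bud q Z \<open>3 \<le> C\<close> by presburger
    ultimately show ?thesis using q by auto
  qed
  have fin: "finite {..<path_length}" by simp
  have i: "i \<in> {..<path_length}" using assms by simp
  have "\<forall>i\<in>{..<path_length}. loop_excess i = 0"
    using main sum_nonneg_eq_0_iff[OF fin, of loop_excess] loop_excess_props by (simp add: Z_def)
  then show "loop_excess i = 0" using i by blast
  show "6 * t - 2 * int path_length - (\<Sum>i<path_length. connector_excess i) \<le> 4"
    using main unfolding C_def[symmetric] q_def by simp
  show "connector_excess i = extra_evens i \<or> connector_excess i = 2 \<and> extra_evens i = 0 \<and> 6 * t - 2 - 2 * int path_length = (\<Sum>i<path_length. connector_excess i)"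
  proof (cases "C = I")
    case True
    then have "(\<Sum>i<path_length. connector_excess i - extra_evens i) = 0" by (simp add: sum_subtractf C_def I_def)
    then have "\<forall>i\<in>{..<path_length}. connector_excess i - extra_evens i = 0"
      using sum_nonneg_eq_0_iff[OF fin, of "\<lambda>i. connector_excess i - extra_evens i"] extra_evens_le by simp
    then show ?thesis using i by auto
  next
    case False
    then have C: "C = 2" "I = 0" "q = 0" using main by auto
    then have "\<forall>i\<in>{..<path_length}. extra_evens i = 0"
      using sum_nonneg_eq_0_iff[OF fin, of extra_evens] extra_evens_le by (simp add: I_def)
    then have ii0: "extra_evens i = 0" using i by blast
    have "0 \<le> connector_excess j" for j using extra_evens_le[of j] by linarith
    then have "connector_excess i \<le> C" unfolding C_def using fin i by (intro member_le_sum) auto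
    moreover have "0 \<le> connector_excess i" using extra_evens_le[of i] by linarith
    moreover have "even (connector_excess i)" using par[OF assms] ii0 by simp
    moreover have "c = 0 \<or> c = 2" if "c \<le> 2" "0 \<le> c" "even c" for c :: int using that by presburger
    ultimately have "connector_excess i = 0 \<or> connector_excess i = 2" using C by blast
    then show ?thesis using C ii0 unfolding C_def[symmetric] q_def by auto
  qed
qed

lemma adjacent_of_N:
  assumes "a \<in> Q" "b \<in> Q" "N b = N a + 1"
  shows "adjacent_in_Q a b"
proof -
  have "a < b" using N_less_iff[OF assms(1,2)] assms(3) by simp
  moreover have False if "q \<in> Q" "a < q" "q < b" for q
    using N_strict[OF assms(1) that(2)] N_strict[OF that(1) that(3)] assms(3) by linarith
  ultimately show ?thesis using assms unfolding adjacent_in_Q_def by auto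
qed

text \<open>The bounds of \<open>even_run\<close> are attained, so the even elements of the
  connector advance in steps of exactly 4. Shifted back by \<open>s\<close> they form a progression
  of odd elements starting at \<open>path i\<close>, which are again consecutive in
  \<open>Q\<close>.\<close>

lemma connector_shape:
  assumes "i < path_length" "connector_excess i = extra_evens i"
  shows "j \<le> extra_evens i \<Longrightarrow> 0 \<le> j \<Longrightarrow>
      path i + s + 4 * j \<in> Q \<and> path i + 4 * j \<in> Q \<and>
      G (path i + s + 4 * j) = G (path i + s) + j \<and> G (path i + 4 * j) = G (path i) + j"
    and "\<lbrakk>q \<in> Q; path i + s \<le> q; q < path (Suc i)\<rbrakk> \<Longrightarrow> \<exists>j. 0 \<le> j \<and> j \<le> extra_evens i \<and> q = path i + s + 4 * j"
    and "path i + s + 4 * extra_evens i < path (Suc i)"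
proof -
  define p A where "p = path i" and "A = path i + s"
  have pQ: "p \<in> Q" "odd p" using path_Q by (auto simp: p_def)
  have A: "A \<in> Q" "even A" using loop_end[OF pQ] by (simp_all add: A_def p_def)
  obtain \<alpha> where \<alpha>: "adjacent_in_Q \<alpha> (path (Suc i))" "A \<le> \<alpha>"
      and ev: "\<And>q. \<lbrakk>q \<in> Q; A \<le> q; q \<le> \<alpha>\<rbrakk> \<Longrightarrow> even q"
    using last_even_before[OF A] path_next[of i] unfolding A_def by metis
  have \<alpha>Q: "\<alpha> \<in> Q" "\<alpha> < path (Suc i)" using \<alpha> by (auto simp: adjacent_in_Q_def)
  have \<alpha>P: "\<alpha> \<le> P" using path_le_P[OF assms(1)] \<alpha>Q by simp
  have A1: "1 \<le> A" using path_pos[of i] P_pos by (simp add: A_def)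
  have N\<alpha>: "N \<alpha> = N A + extra_evens i" using adjacent_N[OF \<alpha>(1)] by (simp add: extra_evens_def A_def)
  have "G \<alpha> \<le> G A + extra_evens i" using adjacent_G_mono[OF \<alpha>(1)] assms(2) by (simp add: connector_excess_def A_def)
  \<comment> \<open>\<open>G\<close> grows at least once per step both before and after
    \<open>x\<close>, and the total leaves no surplus, so both bounds are equalities.\<close>
  then have exact: "G x = G A + (N x - N A) \<and> x = A + 4 * (N x - N A)"
    if x: "x \<in> Q" "A \<le> x" "x \<le> \<alpha>" for x
  proof -
    have "N x - N A \<le> G x - G A" using even_run[OF A(1) x(1,2)] ev x by auto
    moreover have "N \<alpha> - N x \<le> G \<alpha> - G x" using even_run[OF x(1) \<alpha>Q(1) x(3)] ev x by auto
    ultimately have g: "G x = G A + (N x - N A)" using N\<alpha> \<open>G \<alpha> \<le> G A + extra_evens i\<close> by linarith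
    have "D A = 1" "D x = 1" using D_1 A1 x \<alpha>P by auto
    then show ?thesis using g G_diff[of x A] by (simp add: J_eq_D)
  qed
  have mem: "A + 4 * int j \<in> Q \<and> N (A + 4 * int j) = N A + int j \<and> A + 4 * int j \<le> \<alpha>" if "int j \<le> extra_evens i" for j
    using that
  proof (induction j)
    case 0
    then show ?case using A \<alpha> by simp
  next
    case (Suc j)
    then have IH: "A + 4 * int j \<in> Q" "N (A + 4 * int j) = N A + int j" "A + 4 * int j \<le> \<alpha>" by auto
    have "N (A + 4 * int j) < N \<alpha>" using IH N\<alpha> Suc.prems by simp
    then have "A + 4 * int j < \<alpha>" using N_less_iff[OF IH(1) \<alpha>Q(1)] by simp
    then obtain x where x: "adjacent_in_Q (A + 4 * int j) x" "x \<le> \<alpha>"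
      using succ_upto[OF IH(1) \<alpha>Q(1)] by metis
    have xQ: "x \<in> Q" "A + 4 * int j < x" using x by (auto simp: adjacent_in_Q_def)
    have Nx: "N x = N A + int j + 1" using adjacent_N[OF x(1)] IH by simp
    then have "x = A + 4 * int (Suc j)" using exact[of x] xQ x by simp
    then show ?case using xQ Nx x by simp
  qed
  have low: "N (p + 4 * int j) = N p + int j \<and> p + 4 * int j \<in> Q" if "int j \<le> extra_evens i" for j
    using that
  proof (induction j)
    case 0
    then show ?case using pQ by simp
  next
    case (Suc j)
    define a where "a = p + 4 * int j"
    have IH: "N a = N p + int j" "a \<in> Q" using Suc by (auto simp: a_def)
    have "A + 4 * int (Suc j) \<in> Q" "A + 4 * int (Suc j) \<le> \<alpha>" using mem[OF Suc.prems] by auto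
    then have b: "a + 4 \<in> Q" "a + 4 + s \<le> P"
      using loop_start[of "A + 4 * int (Suc j)"] A(2) \<alpha>P
      by (auto simp: a_def A_def p_def algebra_simps)
    have oa: "odd a" using pQ by (simp add: a_def)
    \<comment> \<open>Such an element would have distance 3 from \<open>a\<close>, hence distance 1
      from \<open>a + 4\<close>, and no copy of the edge lies there.\<close>
    have False if "q \<in> Q" "a < q" "q < a + 4" for q
    proof -
      have q: "q = a + 3" using gap_odd[OF IH(2) that(1,2) oa] that by simp
      have "1 \<le> a" using path_pos[of i] by (simp add: a_def p_def)
      then have "\<not> P dvd q" using no_defect_inside[of q] b q P_pos by simp
      then show False using gap[OF that(1) b(1)] q by simp
    qed
    then have "adjacent_in_Q a (a + 4)" using IH b unfolding adjacent_in_Q_def by auto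
    then show ?case using adjacent_N IH b by (force simp: a_def algebra_simps)
  qed
  show "path i + s + 4 * j \<in> Q \<and> path i + 4 * j \<in> Q \<and>
      G (path i + s + 4 * j) = G (path i + s) + j \<and> G (path i + 4 * j) = G (path i) + j"
    if j: "j \<le> extra_evens i" "0 \<le> j"
  proof -
    obtain k where k: "j = int k" using j(2) nonneg_int_cases by blast
    have 1: "A + 4 * j \<in> Q" "N (A + 4 * j) = N A + j" "A + 4 * j \<le> \<alpha>" using mem[of k] j k by auto
    have 2: "N (p + 4 * j) = N p + j" "p + 4 * j \<in> Q" using low[of k] j k by auto
    have "G (A + 4 * j) = G A + j" using exact[of "A + 4 * j"] 1 j by simp
    moreover have "D p = 1" "D (p + 4 * j) = 1"
      using D_1[of p] D_1[of "p + 4 * j"] path_pos[of i] 1 j \<alpha>P P_pos by (auto simp: p_def A_def)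
    then have "G (p + 4 * j) = G p + j" using G_diff[of "p + 4 * j" p] 2 by (simp add: J_eq_D)
    ultimately show ?thesis using 1 2 by (simp add: p_def A_def)
  qed
  have "int (nat (extra_evens i)) = extra_evens i" using extra_evens_le(1)[of i] by simp
  then have "A + 4 * extra_evens i \<le> \<alpha>" using mem[of "nat (extra_evens i)"] by simp
  then show "path i + s + 4 * extra_evens i < path (Suc i)" using \<alpha>Q by (simp add: A_def)
  show "\<exists>j. 0 \<le> j \<and> j \<le> extra_evens i \<and> q = path i + s + 4 * j"
    if q: "q \<in> Q" "path i + s \<le> q" "q < path (Suc i)"
  proof -
    have "q \<le> \<alpha>" using \<alpha>(1) q unfolding adjacent_in_Q_def by force
    then have "q = A + 4 * (N q - N A)" "N A \<le> N q" "N q \<le> N \<alpha>"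
      using exact[of q] q N_le_iff[OF A(1) q(1)] N_le_iff[OF q(1) \<alpha>Q(1)] by (auto simp: A_def)
    then show ?thesis using N\<alpha> by (intro exI[of _ "N q - N A"]) (simp add: A_def)
  qed
qed

text \<open>
  An odd element between two consecutive path points is squeezed by their values of \<open>G\<close>.
\<close>

lemma loop_const:
  assumes B: "B \<in> Q" "odd B" "1 \<le> B" "B + s \<le> P"
  shows "G (B + s) = G B + 2"
proof -
  obtain z where z: "0 \<le> z" "G (B + s) = G B + 2 + 3 * z" using loop_inside[OF B] .
  define i where "i = (LEAST i. B < path (Suc i))"
  have "B < path (Suc (nat B))" using path_ge[of "Suc (nat B)"] B by simp
  then have i: "B < path (Suc i)" unfolding i_def by (rule LeastI)
  have ge: "path i \<le> B"
  proof (cases i)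
    case 0
    then show ?thesis using B by (simp add: path_0)
  next
    case (Suc j)
    then show ?thesis using not_less_Least[of j "\<lambda>i. B < path (Suc i)"] unfolding i_def by force
  qed
  have iL: "i < path_length"
  proof (rule ccontr)
    assume "\<not> i < path_length"
    then have "path path_length \<le> path i" by (intro path_mono) simp
    then show False using path_length_props(1) ge B by simp
  qed
  define p where "p = path i"
  define b where "b = path (Suc i)"
  have p: "p \<in> Q" "odd p" "1 \<le> p" "p + s \<le> P"
    using path_Q path_pos path_length_props(2)[OF iL] by (auto simp: p_def)
  have b: "b \<in> Q" "odd b" using path_Q by (auto simp: b_def)
  have GA: "G (p + s) = G p + 2" using path_budget(1)[OF iL] by (simp add: loop_excess_def p_def)
  have Gb: "G b = G p + 2 + connector_excess i" using GA by (simp add: connector_excess_def p_def b_def)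
  have B': "B + s \<in> Q" "even (B + s)" using loop_end B by auto
  have end_next: "b + s \<in> Q \<and> b + s \<le> P \<and> G (b + s) = G p + 4 + connector_excess i" if "Suc i < path_length"
    using that path_budget(1)[OF that] Gb path_length_props(2)[OF that] loop_end[OF b] by (simp add: loop_excess_def b_def)
  have end_last: "6 * t - 2 = G p + 4 + connector_excess i + (6 * t - 4 - 2 * int path_length - (\<Sum>i<path_length. connector_excess i))" if "path_length = Suc i"
  proof -
    have "(\<Sum>i<path_length. loop_excess i) = 0" using path_budget(1) by simp
    then have "G b = 2 * int path_length + (\<Sum>i<path_length. connector_excess i)" using path_sums[of path_length] that by (simp add: b_def)
    then show ?thesis using Gb by simp
  qed
  \<comment> \<open>The comparison point is the end of the next loop of the path, or
    \<open>P\<close> if \<open>i\<close> is its last loop.\<close>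
  have upper: "G (B + s) \<le> G p + 4 + connector_excess i"
  proof (cases "Suc i < path_length")
    case True
    then show ?thesis using end_next[OF True] G_mono[OF B'(1), of "b + s"] i by (simp add: b_def)
  next
    case False
    then have "path_length = Suc i" using iL by simp
    then have "6 * t - 2 \<le> G p + 4 + connector_excess i" using end_last path_budget(3)[OF iL] by linarith
    then show ?thesis using G_mono[OF B'(1) P_Q(1) B(4)] G_P by simp
  qed
  have GpB: "G p \<le> G B" using G_mono[OF p(1) B(1)] ge by (simp add: p_def)
  from path_budget(2)[OF iL] show ?thesis
  proof (elim disjE conjE)
    assume eq: "connector_excess i = extra_evens i"
    note shape = connector_shape[OF iL eq, folded p_def b_def]
    show ?thesis
    proof (cases "B + s < b")
      case True
      then obtain j where j: "0 \<le> j" "j \<le> extra_evens i" "B + s = p + s + 4 * j"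
        using shape(2)[of "B + s"] B' ge by (auto simp: p_def)
      then have "B = p + 4 * j" by simp
      then show ?thesis using shape(1)[of j] j GA by (simp add: algebra_simps)
    next
      case False
      have k: "p + 4 * extra_evens i \<in> Q" "G (p + 4 * extra_evens i) = G p + extra_evens i" "p + s + 4 * extra_evens i \<in> Q"
        using shape(1)[of "extra_evens i"] extra_evens_le(1)[of i] by auto
      have "p + s + 4 * extra_evens i < b" using shape(3) .
      then have "p + 4 * extra_evens i \<le> B" using False by simp
      then have "G p + extra_evens i \<le> G B" using G_mono[OF k(1) B(1)] k by simp
      \<comment> \<open>\<open>G B + 2 + 3 z\<close> is squeezed between
        \<open>G p + extra_evens i + 2 + 3 z\<close> and \<open>G p + extra_evens i + 4\<close>, so
        \<open>3 z \<le> 2\<close>.\<close>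
      then have "z = 0" using upper z eq by simp
      then show ?thesis using z by simp
    qed
  next
    assume c: "connector_excess i = 2" "extra_evens i = 0" "6 * t - 2 - 2 * int path_length = (\<Sum>i<path_length. connector_excess i)"
    show ?thesis
    proof (cases "Suc i < path_length")
      case False
      then have "path_length = Suc i" using iL by simp
      then have "6 * t - 2 = G p + 4" using end_last c by simp
      then have "z = 0" using G_mono[OF B'(1) P_Q(1) B(4)] G_P GpB z by simp
      then show ?thesis using z by simp
    next
      case True
      have bP: "b + s \<in> Q" "b + s \<le> P" "G (b + s) = G p + 6" using end_next[OF True] c by auto
      have "D b = 1" using D_1[of b] bP P_pos path_pos[of "Suc i"] by (simp add: b_def)
      then have b5: "b = p + s + 5" using time_step[OF iL] c s_def by (simp add: b_def p_def)
      show ?thesis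
      proof (rule ccontr)
        assume ne: "G (B + s) \<noteq> G B + 2"
        then have "5 \<le> G (B + s) - G B" using z by auto
        moreover have "G (B + s) \<le> G (b + s)" using G_mono[OF B'(1) bP(1)] i by (simp add: b_def)
        \<comment> \<open>\<open>G\<close> grows by 6 from \<open>p\<close> to \<open>b + s\<close>,
          so a loop that takes at least 5 leaves no growth before it or none behind it. Such a flat
          run yields an element of \<open>Q\<close> at distance 1 from an end of the connector of
          length 5.\<close>
        ultimately have "G p = G B \<or> G (B + s) = G (b + s)" using GpB bP by linarith
        then show False
        proof
          assume "G p = G B"
          moreover have "p \<noteq> B" using ne GA by auto
          then have "p < B" using ge by (simp add: p_def)
          moreover have "B \<le> P" using B P_pos by simp
          ultimately have "p + 6 \<in> Q" using zero_run_right[OF p(1) B(1) p(3)] p B by simp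
          then have "p + 6 + s \<in> Q" using loop_end[of "p + 6"] p by simp
          then show False using gap_odd[OF b(1) _ _ b(2), of "p + 6 + s"] b5 by simp
        next
          assume "G (B + s) = G (b + s)"
          moreover have "B + s < b + s" "1 \<le> B + s" using i B P_pos by (auto simp: b_def)
          moreover have "even (b + s)" using b odd_s by simp
          ultimately have "b + s - 6 \<in> Q" using zero_run_left[OF B'(1) bP(1)] bP B' by simp
          then have "b + s - 6 - s \<in> Q" using loop_start[of "b + s - 6"] b odd_s by simp
          moreover have "b + s - 6 - s = p + s - 1" using b5 by simp
          ultimately have "p + s - 1 \<in> Q" by (simp only:)
          moreover have "p + s \<in> Q" "odd (p + s - 1)" using loop_end[OF p(1,2)] by auto
          ultimately show False using gap_odd[of "p + s - 1" "p + s"] by simp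
        qed
      qed
    qed
  qed
qed

section \<open>Loops across the edge\<close>

text \<open>The loop ending at \<open>P\<close> and the loop starting at 1 grow by exactly 2. Within
  distance \<open>s\<close> this confines \<open>G\<close> to values from \<open>-2\<close> to 0
  before the edge and from 0 to 2 behind it. The correction at the edge makes the growth of a
  crossing loop 1 modulo 3.\<close>

lemma crossing:
  assumes "B \<in> Q" "odd B" "- s < B" "B < 0"
  shows "-2 \<le> G B" "G B \<le> 0" "0 \<le> G (B + s)" "G (B + s) \<le> 2"
    "G (B + s) - G B = 6 * t + 1 - 3 * (N (B + s) - N B)"
proof -
  have A: "B + s \<in> Q" "even (B + s)" using loop_end[OF assms(1,2)] by auto
  have "G (P - s + s) = G (P - s) + 2" using loop_const[OF P_minus_s] by simp
  then have "G (P - s) = 6 * t - 4" using G_P by simp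
  then have "G (- s) = -2" using G_shift[of "- s"] by (simp add: algebra_simps)
  moreover have "- s \<in> Q" using loop_start[of 0] zero_one_Q by simp
  ultimately show "-2 \<le> G B" using G_mono[of "- s" B] assms by simp
  show "G B \<le> 0" using G_mono[OF assms(1) zero_one_Q(1)] assms G_0 by simp
  have pos: "1 \<le> B + s" using assms by simp
  show "0 \<le> G (B + s)" using G_mono[OF zero_one_Q(2) A(1) pos] G_1 by simp
  have "1 + s \<le> P" using P_gt s_def t2 by linarith
  then have "G (1 + s) = 2" "1 + s \<in> Q"
    using loop_const[of 1] loop_end[of 1] zero_one_Q G_1 by auto
  then show "G (B + s) \<le> 2" using G_mono[OF A(1), of "1 + s"] assms by simp
  have "D B = 0" "D (B + s) = 1"
    using D_0[of B] D_1[of "B + s"] assms P_pos pos by auto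
  then show "G (B + s) - G B = 6 * t + 1 - 3 * (N (B + s) - N B)"
    using G_diff[of "B + s" B] s_def by (simp add: J_eq_D)
qed

lemma crossing_cases:
  assumes "B \<in> Q" "odd B" "- s < B" "B < 0"
  shows "N (B + s) - N B = 2 * t \<and> G (B + s) - G B = 1
    \<or> N (B + s) - N B = 2 * t - 1 \<and> G (B + s) - G B = 4"
proof -
  define m d where "m = N (B + s) - N B" and "d = G (B + s) - G B"
  have "0 \<le> d" "d \<le> 4" "d = 6 * t + 1 - 3 * m" using crossing[OF assms] by (auto simp: d_def m_def)
  then have "m = 2 * t \<and> d = 1 \<or> m = 2 * t - 1 \<and> d = 4" by presburger
  then show ?thesis by (simp add: m_def d_def)
qed

text \<open>Growth 4 requires the extreme values \<open>-2\<close> and 2. By monotonicity any other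
  crossing loop then has an extreme value at one end, and growth 1 would push its other end out of
  range.\<close>

lemma crossing_const:
  assumes B: "B \<in> Q" "odd B" "- s < B" "B < 0"
    and C: "C \<in> Q" "odd C" "- s < C" "C < 0"
    and "N (B + s) - N B = 2 * t"
  shows "N (C + s) - N C = 2 * t"
proof (rule ccontr)
  assume "N (C + s) - N C \<noteq> 2 * t"
  then have c: "G (C + s) - G C = 4" using crossing_cases[OF C] by auto
  have b: "G (B + s) - G B = 1" using crossing_cases[OF B] assms(9) by auto
  note bb = crossing(1-4)[OF B] and cb = crossing(1-4)[OF C]
  have "B + s \<in> Q" "C + s \<in> Q" using loop_end B C by auto
  then have "B \<le> C \<Longrightarrow> G B \<le> G C" "C \<le> B \<Longrightarrow> G (C + s) \<le> G (B + s)"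
      "B \<le> C \<Longrightarrow> G (B + s) \<le> G (C + s)" "C \<le> B \<Longrightarrow> G C \<le> G B"
    using G_mono B C by auto
  then show False using b c bb cb by linarith
qed

lemma odd_representative:
  assumes "B \<in> Q" "odd B"
  obtains B' k where "B = B' + P * k" "B' \<in> Q" "odd B'"
    "(- s < B' \<and> B' < 0) \<or> (1 \<le> B' \<and> B' + s \<le> P)"
proof -
  define k where "k = D (B + s) - 1"
  define B' where "B' = B - P * k"
  have bd: "- s < B'" "B' + s \<le> P" using D_bounds[of "B + s"] by (auto simp: B'_def k_def)
  have "B' \<in> Q" using Q_period_iter[of B' k] assms by (simp add: B'_def)
  moreover have "odd B'" using assms P_Q by (simp add: B'_def)
  moreover from this have "B' \<noteq> 0" by auto
  then have "B' < 0 \<or> 1 \<le> B'" by linarith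
  moreover have "B = B' + P * k" by (simp add: B'_def)
  ultimately show thesis using that[of B' k] bd by blast
qed

lemma loop_inside_N:
  assumes "B \<in> Q" "odd B" "1 \<le> B" "B + s \<le> P"
  shows "N (B + s) - N B = 2 * t - 1"
proof -
  obtain z where "0 \<le> z" "G (B + s) = G B + 2 + 3 * z" "N (B + s) - N B = 2 * t - 1 - z"
    using loop_inside[OF assms] .
  then show ?thesis using loop_const[OF assms] by simp
qed

section \<open>Parity as a function of the index in \<open>Q\<close>\<close>

lemma N_surj: obtains q where "q \<in> Q" "N q = i"
proof -
  define k where "k = i div (2 * r)"
  define j where "j = i mod (2 * r)"
  have r0: "0 < 2 * r" using r_pos by simp
  have j: "0 \<le> j" "j < 2 * r" "i = 2 * r * k + j" using r0 by (simp_all add: k_def j_def)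
  \<comment> \<open>\<open>N\<close> climbs from 0 to \<open>2 r\<close> on \<open>{0..P}\<close> in
    steps of at most 1, so the largest argument with \<open>N q \<le> j\<close> is an element of
    \<open>Q\<close> with index \<open>j\<close>.\<close>
  define S where "S = {q. 0 \<le> q \<and> q \<le> P \<and> N q \<le> j}"
  have fin: "finite S" unfolding S_def by (rule finite_subset[of _ "{0..P}"]) auto
  have "0 \<in> S" using P_pos N_0 j by (simp add: S_def)
  define q where "q = Max S"
  have qS: "q \<in> S" using Max_in[OF fin] \<open>0 \<in> S\<close> unfolding q_def by blast
  then have "q \<noteq> P" using N_P j by (auto simp: S_def)
  then have "q + 1 \<le> P" "0 \<le> q + 1" using qS by (auto simp: S_def)
  moreover have "q + 1 \<notin> S" using Max_ge[OF fin, of "q + 1"] unfolding q_def by auto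
  ultimately have "j < N (q + 1)" by (auto simp: S_def)
  moreover have "N q \<le> j" using qS by (simp add: S_def)
  ultimately have "q \<in> Q" "N q = j"
    using count_below_Suc[of Q q] by (auto simp: N_def split: if_splits)
  then show thesis using that[of "q + P * k"] Q_period_iter[of q k] N_period_iter[of q k] j by simp
qed

text \<open>The index function is a parameter because two are used: \<open>N\<close>, and
  \<open>N - D\<close>, which gives both ends of a copy of the edge the same index.\<close>

definition even_at :: "(int \<Rightarrow> int) \<Rightarrow> int \<Rightarrow> bool" where
  "even_at M i \<longleftrightarrow> (\<exists>q\<in>Q. even q \<and> M q = i)"
definition odd_at :: "(int \<Rightarrow> int) \<Rightarrow> int \<Rightarrow> bool" where
  "odd_at M i \<longleftrightarrow> (\<exists>q\<in>Q. odd q \<and> M q = i)"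

lemma even_at_iff_odd_at_shift:
  assumes "\<And>B. \<lbrakk>B \<in> Q; odd B\<rbrakk> \<Longrightarrow> M (B + s) = M B + h"
  shows "even_at M i \<longleftrightarrow> odd_at M (i - h)"
proof
  assume "even_at M i"
  then obtain q where q: "q \<in> Q" "even q" "M q = i" by (auto simp: even_at_def)
  then have "q - s \<in> Q" "odd (q - s)" using loop_start by auto
  moreover from this have "M (q - s) = i - h" using assms[of "q - s"] q by simp
  ultimately show "odd_at M (i - h)" unfolding odd_at_def by blast
next
  assume "odd_at M (i - h)"
  then obtain q where q: "q \<in> Q" "odd q" "M q = i - h" by (auto simp: odd_at_def)
  then have "q + s \<in> Q" "even (q + s)" using loop_end by auto
  moreover have "M (q + s) = i" using assms[of q] q by simp
  ultimately show "even_at M i" unfolding even_at_def by blast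
qed

text \<open>
  If crossing loops were longer, then after identifying the indices of 0 and 1 every loop would
  have index length \<open>h = 2 t - 1\<close> on a cycle of length \<open>m = 2 r - 1\<close>. As \<open>(6 t - 1) h = 2 m - 1\<close>, the successor
  of 1 would be odd and the predecessor of 0 even, and \<open>G\<close> would grow too much across the edge.
\<close>

lemma no_long_crossing:
  assumes "C \<in> Q" "odd C" "- s < C" "C < 0"
  shows "N (C + s) - N C = 2 * t - 1"
proof (rule ccontr)
  assume "N (C + s) - N C \<noteq> 2 * t - 1"
  then have C1: "N (C + s) - N C = 2 * t" "G (C + s) - G C = 1" using crossing_cases[OF assms] by auto
  define M where "M q = N q - D q" for q
  define m where "m = 2 * r - 1"
  define h where "h = 2 * t - 1"
  have m6: "6 * t - 1 < m"
  proof -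
    have "0 \<le> (t - 2) * (6 * t + 2)" using t2 by simp
    then show ?thesis using t2 by (simp add: m_def r_def algebra_simps)
  qed
  have M_period: "M (q + P * k) = M q + m * k" for q k
  proof -
    have "D (q + P * k) = D q + k"
      using D_eq[of "D q + k - 1" "q + P * k"] D_bounds[of q] by (simp add: algebra_simps)
    then show ?thesis using N_period_iter[of q k] by (simp add: M_def m_def algebra_simps)
  qed
  have M_shift: "M (B + s) = M B + h" if "B \<in> Q" "odd B" for B
  proof -
    obtain B' k where B': "B = B' + P * k" "B' \<in> Q" "odd B'"
        "(- s < B' \<and> B' < 0) \<or> (1 \<le> B' \<and> B' + s \<le> P)"
      using odd_representative[OF \<open>B \<in> Q\<close> \<open>odd B\<close>] .
    have "M (B' + s) = M B' + h"
      using B'(4)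
    proof
      assume c: "- s < B' \<and> B' < 0"
      then have "N (B' + s) - N B' = 2 * t" using crossing_const[OF assms B'(2,3) _ _ C1(1)] by blast
      moreover have "D B' = 0" "D (B' + s) = 1" using D_0[of B'] D_1[of "B' + s"] c P_pos by auto
      ultimately show ?thesis by (simp add: M_def h_def)
    next
      assume c: "1 \<le> B' \<and> B' + s \<le> P"
      then have "D B' = 1" "D (B' + s) = 1" using D_1[of B'] D_1[of "B' + s"] P_pos by auto
      then show ?thesis using loop_inside_N[OF B'(2,3)] c by (simp add: M_def h_def)
    qed
    moreover have eq: "B + s = B' + s + P * k" using B'(1) by simp
    ultimately show ?thesis unfolding eq using M_period[of B' k] M_period[of "B' + s" k] B'(1) by simp
  qed
  have rep: "\<exists>q' k. q = q' + P * k \<and> q' \<in> Q \<and> 1 \<le> N q' \<and> N q' \<le> 2 * r \<and> M q' = N q' - 1 \<and> 1 \<le> q' \<and> q' \<le> P"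
    if "q \<in> Q" for q
  proof -
    define k where "k = D q - 1"
    define q' where "q' = q - P * k"
    have q': "1 \<le> q'" "q' \<le> P" using D_bounds[of q] by (auto simp: q'_def k_def)
    have "q' \<in> Q" using Q_period_iter[of q' k] that by (simp add: q'_def)
    then have "1 \<le> N q'" "N q' \<le> 2 * r"
      using N_le_iff[OF zero_one_Q(2)] N_le_iff[OF _ P_Q(1)] N_1 N_P q' by auto
    moreover have "M q' = N q' - 1" using D_1[OF q'] by (simp add: M_def)
    ultimately show ?thesis using \<open>q' \<in> Q\<close> q' by (intro exI[of _ q'] exI[of _ k]) (simp add: q'_def)
  qed
  have E_F: "even_at M i \<longleftrightarrow> odd_at M (i - h)" for i by (rule even_at_iff_odd_at_shift) (rule M_shift)
  have total: "even_at M i \<or> odd_at M i" for i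
  proof -
    obtain q where q: "q \<in> Q" "N q = i mod m + 1" by (rule N_surj)
    have "0 \<le> i mod m" "i mod m < m" using m6 t2 by auto
    then have "1 \<le> N q" "N q \<le> 2 * r" using q by (auto simp: m_def)
    then have "1 \<le> q" "q \<le> P"
      using N_le_iff[OF zero_one_Q(2) q(1)] N_le_iff[OF q(1) P_Q(1)] N_1 N_P by auto
    then have "M q = i mod m" using q D_1 by (simp add: M_def)
    then have "M (q + P * (i div m)) = i" using M_period[of q "i div m"] by simp
    moreover have "q + P * (i div m) \<in> Q" using Q_period_iter q by blast
    ultimately show ?thesis unfolding even_at_def odd_at_def by blast
  qed
  have both: "m dvd i" if EF: "even_at M i" "odd_at M i" for i
  proof (rule ccontr)
    assume nd: "\<not> m dvd i"
    have uniq: "N q' = i mod m + 1 \<and> k = i div m"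
      if q: "M (q' + P * k) = i" "1 \<le> N q'" "N q' \<le> 2 * r" "M q' = N q' - 1" for q' k
    proof -
      have i: "i = m * k + (N q' - 1)" using q M_period[of q' k] by simp
      have "N q' - 1 \<noteq> m" using nd i by auto
      then have "N q' - 1 < m" "0 \<le> N q' - 1" using q by (auto simp: m_def)
      then have "i div m = k" "i mod m = N q' - 1" using i m6 t2 by auto
      then show ?thesis by simp
    qed
    obtain a b where a: "a \<in> Q" "even a" "M a = i" and b: "b \<in> Q" "odd b" "M b = i"
      using EF by (auto simp: even_at_def odd_at_def)
    obtain a' k where a': "a = a' + P * k" "a' \<in> Q" "1 \<le> N a'" "N a' \<le> 2 * r" "M a' = N a' - 1"
      using rep[OF a(1)] by blast
    obtain b' l where b': "b = b' + P * l" "b' \<in> Q" "1 \<le> N b'" "N b' \<le> 2 * r" "M b' = N b' - 1"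
      using rep[OF b(1)] by blast
    have "N a' = N b'" "k = l" using uniq[of a' k] uniq[of b' l] a a' b b' by auto
    then have "a = b" using N_inj[OF a'(2) b'(2)] a'(1) b'(1) by simp
    then show False using a b by simp
  qed
  have E0: "even_at M 0" unfolding even_at_def using zero_one_Q D_0[of 0] N_0 P_pos
    by (intro bexI[of _ 0]) (auto simp: M_def)
  have F0: "odd_at M 0" unfolding odd_at_def using zero_one_Q D_1[of 1] N_1 P_pos
    by (intro bexI[of _ 1]) (auto simp: M_def)
  define k where "k = nat (6 * t - 1)"
  have k: "int k = 6 * t - 1" "0 < k" "odd k"
  proof -
    show "int k = 6 * t - 1" "0 < k" using t2 by (simp_all add: k_def)
    then have "odd (int k)" by simp
    then show "odd k" by simp
  qed
  have kh: "int k * h = 2 * m - 1"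
    unfolding k(1) by (simp add: h_def m_def r_def algebra_simps)
  \<comment> \<open>As \<open>k h = 2 m - 1\<close>, multiplication by \<open>k\<close> turns
    \<open>j h\<close> into \<open>- j\<close> modulo \<open>m\<close>, and
    \<open>0 < j < k < m\<close>.\<close>
  have free: "\<not> m dvd int j * h" if "0 < j" "j < k" for j
  proof
    assume "m dvd int j * h"
    then have "m dvd (int j * h) * int k" by simp
    moreover have "(int j * h) * int k = int j * (int k * h)" by simp
    then have "int j = m * (2 * int j) - (int j * h) * int k" unfolding kh by (simp add: algebra_simps)
    ultimately have "m dvd int j" by (metis dvd_diff dvd_triv_left)
    then show False using zdvd_not_zless[of "int j" m] that k m6 by auto
  qed
  have "odd_at M (- (int k * h))"
    using alternating_chain[of "even_at M" "odd_at M" h m k, OF E_F total both E0 free] k by simp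
  then obtain a where a: "a \<in> Q" "odd a" "M a = 1 - 2 * m" unfolding kh by (auto simp: odd_at_def)
  have "even_at M (int k * h)"
  proof -
    \<comment> \<open>The same chain runs upwards from the odd element of index 0: indices are
      reflected and parities exchanged.\<close>
    have "if odd k then even_at M (- (- (int k * h))) else odd_at M (- (- (int k * h)))"
    proof (rule alternating_chain[of "\<lambda>i. odd_at M (- i)" "\<lambda>i. even_at M (- i)" h m k])
      show "odd_at M (- i) = even_at M (- (i - h))" for i using E_F[of "h - i"] by simp
      show "odd_at M (- i) \<or> even_at M (- i)" for i using total by blast
      show "m dvd i" if "odd_at M (- i)" "even_at M (- i)" for i using both[OF that(2,1)] by simp
    qed (use F0 free k in auto)
    then show ?thesis using k by simp
  qed
  then obtain b where b: "b \<in> Q" "even b" "M b = 2 * m - 1" unfolding kh by (auto simp: even_at_def)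
  \<comment> \<open>Modulo \<open>m\<close> the index \<open>1 - 2 m\<close> is that of the element
    right behind 1; likewise \<open>2 m - 1\<close> belongs to the element right before 0.\<close>
  have a1: "\<exists>q\<in>Q. odd q \<and> N q = 2"
  proof -
    obtain a' l where a': "a = a' + P * l" "a' \<in> Q" "1 \<le> N a'" "N a' \<le> 2 * r" "M a' = N a' - 1"
      using rep[OF a(1)] by blast
    have "m * (l + 2) + (N a' - 1) = 1" using M_period[of a' l] a a' by (simp add: algebra_simps)
    moreover have "0 \<le> N a' - 1" "N a' - 1 \<le> m" using a' by (auto simp: m_def)
    moreover have "l + 2 = 0" 
    proof (rule ccontr)
      assume "l + 2 \<noteq> 0"
      then consider "1 \<le> l + 2" | "l + 2 \<le> -1" by linarith
      then show False
      proof cases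
        case 1
        then have "m * 1 \<le> m * (l + 2)" using m6 t2 by (intro mult_left_mono) auto
        then show False using calculation m6 t2 by linarith
      next
        case 2
        then have "m * (l + 2) \<le> m * (-1)" using m6 t2 by (intro mult_left_mono) auto
        then show False using calculation m6 t2 by linarith
      qed
    qed
    ultimately have "N a' = 2" by simp
    moreover have "odd a'" using a a' P_Q by simp
    ultimately show ?thesis using a' by blast
  qed
  have b1: "\<exists>q\<in>Q. even q \<and> N q = -1"
  proof -
    obtain b' l where b': "b = b' + P * l" "b' \<in> Q" "1 \<le> N b'" "N b' \<le> 2 * r" "M b' = N b' - 1"
      using rep[OF b(1)] by blast
    have "m * (l - 1) + (N b' - 1) = m - 1" using M_period[of b' l] b b' by (simp add: algebra_simps)
    moreover have "0 \<le> N b' - 1" "N b' - 1 \<le> m" using b' by (auto simp: m_def)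
    moreover have "l - 1 = 0" 
    proof (rule ccontr)
      assume "l - 1 \<noteq> 0"
      then consider "1 \<le> l - 1" | "l - 1 \<le> -1" by linarith
      then show False
      proof cases
        case 1
        then have "m * 1 \<le> m * (l - 1)" using m6 t2 by (intro mult_left_mono) auto
        then show False using calculation m6 t2 by linarith
      next
        case 2
        then have "m * (l - 1) \<le> m * (-1)" using m6 t2 by (intro mult_left_mono) auto
        then show False using calculation m6 t2 by linarith
      qed
    qed
    ultimately have "N b' = 2 * r - 1" by (simp add: m_def)
    then have "N (b' - P) = -1" using N_period[of "b' - P"] by simp
    moreover have "even (b' - P)" "b' - P \<in> Q" using b b' P_Q Q_period[of "b' - P"] by auto
    ultimately show ?thesis by blast
  qed
  obtain a where a: "a \<in> Q" "odd a" "N a = 2" using a1 by blast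
  obtain b where b: "b \<in> Q" "even b" "N b = -1" using b1 by blast
  \<comment> \<open>On each side of the edge two neighbours now have equal parity, so
    \<open>G\<close> grows by 1 on either side. A crossing loop spans both steps and grows by at
    least 2, against \<open>C1\<close>.\<close>
  have "1 \<le> G a"
    using adjacent_same_parity(1)[OF adjacent_of_N[OF zero_one_Q(2) a(1)]] a N_1 G_1 by simp
  moreover have "G b \<le> -1"
    using adjacent_same_parity(1)[OF adjacent_of_N[OF b(1) zero_one_Q(1)]] b N_0 G_0 by simp
  moreover have "G a \<le> G (C + s)"
  proof (rule G_mono)
    have c: "C + s \<in> Q" "even (C + s)" using loop_end assms by auto
    then show "C + s \<in> Q" by simp
    have "1 < C + s" using assms c by presburger
    then have "N a \<le> N (C + s)" using N_strict[OF zero_one_Q(2)] N_1 a by fastforce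
    then show "a \<le> C + s" using N_le_iff[OF a(1) c(1)] by simp
  qed (fact a)
  moreover have "G C \<le> G b"
  proof (rule G_mono)
    have "N C < 0" using N_strict[OF assms(1,4)] N_0 by simp
    then show "C \<le> b" using N_le_iff[OF assms(1) b(1)] b by simp
  qed (fact assms b)+
  ultimately show False using C1 by linarith
qed

lemma N_loop: 
  assumes "B \<in> Q" "odd B"
  shows "N (B + s) = N B + (2 * t - 1)"
proof -
  obtain B' k where B': "B = B' + P * k" "B' \<in> Q" "odd B'"
      "(- s < B' \<and> B' < 0) \<or> (1 \<le> B' \<and> B' + s \<le> P)"
    using odd_representative[OF assms] .
  then have "N (B' + s) - N B' = 2 * t - 1" using no_long_crossing loop_inside_N by blast
  moreover have eq: "B + s = B' + s + P * k" using B'(1) by simp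
  ultimately show ?thesis unfolding eq using N_period_iter[of B' k] N_period_iter[of "B' + s" k] B'(1) by simp
qed

section \<open>The parities alternate\<close>

lemma even_at_iff_not_odd_at: "even_at N i \<longleftrightarrow> \<not> odd_at N i"
proof -
  obtain q where q: "q \<in> Q" "N q = i" by (rule N_surj)
  then have "q' = q" if "q' \<in> Q" "N q' = i" for q' using N_inj that by simp
  then show ?thesis using q unfolding even_at_def odd_at_def by blast
qed

lemma even_at_N: "q \<in> Q \<Longrightarrow> even_at N (N q) \<longleftrightarrow> even q"
  using even_at_iff_not_odd_at[of "N q"] unfolding even_at_def odd_at_def by blast

lemma even_at_period: "even_at N (i + 2 * r * k) \<longleftrightarrow> even_at N i"
proof -
  obtain q where q: "q \<in> Q" "N q = i" by (rule N_surj)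
  have "q + P * k \<in> Q" "N (q + P * k) = i + 2 * r * k" "even (q + P * k) \<longleftrightarrow> even q"
    using Q_period_iter[of q k] N_period_iter[of q k] q P_Q by auto
  then show ?thesis using even_at_N[of q] even_at_N[of "q + P * k"] q by simp
qed

text \<open>A loop shifts the index by \<open>2 t - 1\<close> and flips the parity. Going back along
  \<open>6 t - 1\<close> loops, an odd number, shifts it by \<open>- (4 r - 3)\<close>, which is 3
  modulo the period \<open>2 r\<close>.\<close>

lemma even_at_add_3: "even_at N (i + 3) \<longleftrightarrow> \<not> even_at N i"
proof -
  define h where "h = 2 * t - 1"
  have step: "even_at N i \<longleftrightarrow> \<not> even_at N (i - h)" for i
    using even_at_iff_odd_at_shift[of N h i] N_loop even_at_iff_not_odd_at[of "i - h"] by (simp add: h_def)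
  have flip: "even_at N (i - int k * h) \<longleftrightarrow> (even_at N i \<longleftrightarrow> even k)" for k
  proof (induction k)
    case 0
    then show ?case by simp
  next
    case (Suc k)
    have eq: "i - int (Suc k) * h = (i - int k * h) - h" by (simp add: algebra_simps)
    show ?case unfolding eq using Suc step[of "i - int k * h"] by auto
  qed
  define k where "k = nat (6 * t - 1)"
  have k: "int k = 6 * t - 1" using t2 by (simp add: k_def)
  then have "odd (int k)" by simp
  then have "odd k" by simp
  moreover have "i - int k * h = (i + 3) + 2 * r * (-2)"
    unfolding k by (simp add: h_def r_def algebra_simps)
  ultimately show ?thesis using flip[of k] even_at_period[of "i + 3" "-2"] by metis
qed

lemma even_at_0_1: "even_at N 0" "\<not> even_at N 1"
  using even_at_N[OF zero_one_Q(1)] even_at_N[OF zero_one_Q(2)] N_0 N_1 by auto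

text \<open>
  Otherwise the parities repeat with period six as even, odd, odd, odd, even, even, and \<open>G\<close> grows by
  at least 4 on each such block.
\<close>

lemma even_at_2: "even_at N 2"
proof (rule ccontr)
  assume not2: "\<not> even_at N 2"
  have period6: "even_at N (j + 6 * int k) \<longleftrightarrow> even_at N j" for j k
  proof (induction k)
    case 0
    then show ?case by simp
  next
    case (Suc k)
    have eq: "j + 6 * int (Suc k) = (j + 6 * int k + 3) + 3" by simp
    show ?case unfolding eq using Suc even_at_add_3[of "j + 6 * int k"] even_at_add_3[of "j + 6 * int k + 3"] by simp
  qed
  have up: "G a + 1 \<le> G b" if "a \<in> Q" "b \<in> Q" "N b = N a + 1" "even_at N (N a) \<longleftrightarrow> even_at N (N b)" for a b
    using adjacent_same_parity(1)[OF adjacent_of_N[OF that(1-3)]] that(4) even_at_N[OF that(1)] even_at_N[OF that(2)]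
    by blast
  have keep: "G a \<le> G b" if "a \<in> Q" "b \<in> Q" "N b = N a + 1" for a b
    using adjacent_G_mono[OF adjacent_of_N[OF that]] .
  have pat: "\<not> even_at N 1" "\<not> even_at N 2" "\<not> even_at N 3" "even_at N 4" "even_at N 5" "even_at N 6"
    using even_at_0_1 not2 even_at_add_3[of 0] even_at_add_3[of 1] even_at_add_3[of 2] even_at_add_3[of 3] by auto
  have grow: "\<exists>q\<in>Q. N q = 6 * int k \<and> 4 * int k \<le> G q" for k
  proof (induction k)
    case 0
    then show ?case using zero_one_Q N_0 G_0 by (intro bexI[of _ 0]) auto
  next
    case (Suc k)
    then obtain q0 where q0: "q0 \<in> Q" "N q0 = 6 * int k" "4 * int k \<le> G q0" by blast
    obtain q1 where q1: "q1 \<in> Q" "N q1 = 1 + 6 * int k" by (rule N_surj)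
    obtain q2 where q2: "q2 \<in> Q" "N q2 = 2 + 6 * int k" by (rule N_surj)
    obtain q3 where q3: "q3 \<in> Q" "N q3 = 3 + 6 * int k" by (rule N_surj)
    obtain q4 where q4: "q4 \<in> Q" "N q4 = 4 + 6 * int k" by (rule N_surj)
    obtain q5 where q5: "q5 \<in> Q" "N q5 = 5 + 6 * int k" by (rule N_surj)
    obtain q6 where q6: "q6 \<in> Q" "N q6 = 6 + 6 * int k" by (rule N_surj)
    have "G q0 \<le> G q1" using keep[OF q0(1) q1(1)] q0 q1 by simp
    moreover have "G q1 + 1 \<le> G q2" using up[OF q1(1) q2(1)] q1 q2 period6[of 1 k] period6[of 2 k] pat by simp
    moreover have "G q2 + 1 \<le> G q3" using up[OF q2(1) q3(1)] q2 q3 period6[of 2 k] period6[of 3 k] pat by simp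
    moreover have "G q3 \<le> G q4" using keep[OF q3(1) q4(1)] q3 q4 by simp
    moreover have "G q4 + 1 \<le> G q5" using up[OF q4(1) q5(1)] q4 q5 period6[of 4 k] period6[of 5 k] pat by simp
    moreover have "G q5 + 1 \<le> G q6" using up[OF q5(1) q6(1)] q5 q6 period6[of 5 k] period6[of 6 k] pat by simp
    ultimately have "4 * int (Suc k) \<le> G q6" using q0 by simp
    then show ?case using q6 by (intro bexI[of _ q6]) auto
  qed
  \<comment> \<open>These \<open>k\<close> blocks fit into one period because
    \<open>6 k \<le> 2 r\<close>, but \<open>4 k\<close> exceeds the available growth
    \<open>6 t - 2\<close> by \<open>(4 t - 6) (t - 1)\<close>.\<close>
  define k where "k = nat (t * t - t + 1)"
  have k: "int k = t * t - t + 1" using t_sq t2 by (simp add: k_def)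
  obtain q where q: "q \<in> Q" "N q = 6 * int k" "4 * int k \<le> G q" using grow[of k] by blast
  have "N q \<le> N P" unfolding q(2) N_P k r_def using t2 by (simp add: algebra_simps)
  then have "q \<le> P" using N_le_iff[OF q(1) P_Q(1)] by simp
  then have "4 * int k \<le> 6 * t - 2" using G_mono[OF q(1) P_Q(1)] q G_P by simp
  moreover have "0 < (4 * t - 6) * (t - 1)" using t2 by simp
  ultimately show False unfolding k by (simp add: algebra_simps)
qed

lemma even_at_iff_even: "even_at N i \<longleftrightarrow> even i"
proof -
  have step: "even_at N (i + 6) \<longleftrightarrow> even_at N i" for i
    using even_at_add_3[of i] even_at_add_3[of "i + 3"] by (simp add: add.assoc)
  have per: "even_at N (j + 6 * k) \<longleftrightarrow> even_at N j" for j k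
  proof (induction k rule: int_induct[where k = 0])
    case base
    then show ?case by simp
  next
    case (step1 k)
    then show ?case using step[of "j + 6 * k"] by (simp add: algebra_simps)
  next
    case (step2 k)
    then show ?case using step[of "j + 6 * (k - 1)"] by (simp add: algebra_simps)
  qed
  have pat: "even_at N 0" "\<not> even_at N 1" "even_at N 2" "\<not> even_at N 3" "even_at N 4" "\<not> even_at N 5"
    using even_at_0_1 even_at_2 even_at_add_3[of 0] even_at_add_3[of 1] even_at_add_3[of 2] by auto
  have "i = i mod 6 + 6 * (i div 6)" by simp
  then have "even_at N i \<longleftrightarrow> even_at N (i mod 6)" using per[of "i mod 6" "i div 6"] by metis
  moreover have "even i \<longleftrightarrow> even (i mod 6)" by presburger
  moreover have "i mod 6 \<in> {0, 1, 2, 3, 4, 5}" by (simp; presburger)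
  ultimately show ?thesis using pat by auto
qed

section \<open>Reconstruction of \<open>X\<close> from the alternating parities\<close>

lemma jump:
  assumes "x \<in> X"
  obtains y where "y \<in> X" "N (2 * y) = N (2 * x) + 2 * t" "\<not> n dvd x \<longrightarrow> x + 3 * t + 1 \<le> y"
proof -
  have x: "2 * x \<in> Q" using assms by (simp add: Q_even)
  obtain q where q: "q \<in> Q" "N q = N (2 * x) + 1" by (rule N_surj)
  have "even (N (2 * x))" using even_at_N[OF x] even_at_iff_even by simp
  \<comment> \<open>The successor of \<open>2 x\<close> is odd, and its loop adds
    \<open>2 t - 1\<close> to the index. Off the edge the two moves cover at least
    \<open>3 + s = 2 (3 t + 1)\<close>.\<close>
  then have "odd q" using even_at_N[OF q(1)] even_at_iff_even q by simp
  then have qs: "q + s \<in> Q" "even (q + s)" using loop_end q by auto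
  then obtain y where y: "q + s = 2 * y" by blast
  then have "y \<in> X" using qs by (simp add: Q_even)
  moreover have "N (2 * y) = N (2 * x) + 2 * t" using N_loop[OF q(1) \<open>odd q\<close>] q y by simp
  moreover have "x + 3 * t + 1 \<le> y" if "\<not> n dvd x"
  proof -
    have "\<not> P dvd 2 * x" using that by (simp add: P_def)
    moreover have "2 * x < q" using adjacent_of_N[OF x q] by (simp add: adjacent_in_Q_def)
    ultimately have "2 * x + 3 \<le> q" using gap[OF x q(1)] by blast
    then show ?thesis using y s_def by linarith
  qed
  ultimately show thesis using that by blast
qed

text \<open>Bezout: \<open>r - (3 t - 2) t = 1\<close>.\<close>

lemma coprime_t_r: "r dvd t * k \<Longrightarrow> r dvd k"
proof -
  assume "r dvd t * k"
  then have "r dvd r * k - (3 * t - 2) * (t * k)" by (intro dvd_diff) auto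
  moreover have "r * k - (3 * t - 2) * (t * k) = k" by (simp add: r_def algebra_simps)
  ultimately show ?thesis by simp
qed

text \<open>Let \<open>y k\<close> be the element of \<open>X\<close> with index
  \<open>2 t k\<close>. From \<open>y 1 = 3 t\<close> to \<open>y r = n t = (3 t + 1) r - 1\<close>
  there are \<open>r - 1\<close> steps of length at least \<open>3 t + 1\<close>, and the total
  leaves no room for a longer one.\<close>

theorem progression_in_X:
  assumes "1 \<le> k" "k \<le> r"
  shows "(3 * t + 1) * k - 1 \<in> X"
proof -
  have ex: "\<exists>x. x \<in> X \<and> N (2 * x) = 2 * t * k" for k
  proof -
    obtain q where q: "q \<in> Q" "N q = 2 * t * k" by (rule N_surj)
    then have "even q" using even_at_N[OF q(1)] even_at_iff_even by simp
    then obtain x where "q = 2 * x" by blast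
    then show ?thesis using q by (intro exI[of _ x]) (auto simp: Q_even)
  qed
  define y where "y k = (SOME x. x \<in> X \<and> N (2 * x) = 2 * t * k)" for k
  have "y k \<in> X \<and> N (2 * y k) = 2 * t * k" for k
    unfolding y_def using ex[of k] by (rule someI_ex)
  then have y: "y k \<in> X" "N (2 * y k) = 2 * t * k" for k by simp_all
  have y_eq: "y k = x" if "x \<in> X" "N (2 * x) = 2 * t * k" for x k
  proof -
    have "2 * y k \<in> Q" "2 * x \<in> Q" using that y[of k] by (auto simp: Q_even)
    then have "2 * y k = 2 * x" using N_inj[of "2 * y k" "2 * x"] that y[of k] by simp
    then show ?thesis by simp
  qed
  have y1: "y 1 = 3 * t"
  proof (rule y_eq)
    show "3 * t \<in> X" using defect[OF kappa_1] by simp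
    have "1 + s = 2 * (3 * t)" by (simp add: s_def)
    then show "N (2 * (3 * t)) = 2 * t * 1" using N_loop[OF zero_one_Q(2)] N_1 by simp
  qed
  have yr: "y r = n * t"
  proof (rule y_eq)
    show "n * t \<in> X" using X_period_iter[of 0 t] defect[OF kappa_1] by simp
    have eq: "2 * (n * t) = 0 + P * t" by (simp add: P_def)
    show "N (2 * (n * t)) = 2 * t * r" unfolding eq using N_period_iter[of 0 t] N_0 by simp
  qed
  have y_step: "y k + 3 * t + 1 \<le> y (k + 1)" if "1 \<le> k" "k < r" for k
  proof -
    obtain z where z: "z \<in> X" "N (2 * z) = N (2 * y k) + 2 * t" "\<not> n dvd y k \<longrightarrow> y k + 3 * t + 1 \<le> z"
      using jump[OF y(1)[of k]] .
    have "y (k + 1) = z" by (rule y_eq) (use z y[of k] in \<open>auto simp: algebra_simps\<close>)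
    \<comment> \<open>Only a step starting at a copy of the edge could be shorter. Its index would
      be a multiple of \<open>2 r\<close>, so \<open>r\<close> would divide \<open>t k\<close> and
      hence \<open>k\<close>.\<close>
    moreover have "\<not> n dvd y k"
    proof
      assume "n dvd y k"
      then obtain j where "y k = n * j" by blast
      then have eq: "2 * y k = 0 + P * j" by (simp add: P_def)
      have "2 * t * k = 2 * r * j" using y(2)[of k] N_period_iter[of 0 j] N_0 unfolding eq by simp
      then have "t * k = r * j" by simp
      then have "r dvd t * k" by simp
      then have "r dvd k" by (rule coprime_t_r)
      then show False using zdvd_not_zless[of k r] that by simp
    qed
    ultimately show ?thesis using z by simp
  qed
  have lower: "(3 * t + 1) * k - 1 \<le> y k" if "1 \<le> k" "k \<le> r" for k
    using that
  proof (induction k rule: int_ge_induct)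
    case base
    then show ?case using y1 by simp
  next
    case (step k)
    have "(3 * t + 1) * (k + 1) - 1 = ((3 * t + 1) * k - 1) + 3 * t + 1" by (simp add: algebra_simps)
    then show ?case using step y_step[of k] by simp
  qed
  have upper: "y k \<le> (3 * t + 1) * k - 1" if "k \<le> r" "1 \<le> k" for k
    using that
  proof (induction k rule: int_le_induct)
    case base
    have "(3 * t + 1) * r - 1 = n * t" by (subst n_def) (simp add: r_def algebra_simps)
    then show ?case using yr by simp
  next
    case (step k)
    have "(3 * t + 1) * k - 1 = ((3 * t + 1) * (k - 1) - 1) + 3 * t + 1" by (simp add: algebra_simps)
    then show ?case using step y_step[of "k - 1"] by simp
  qed
  show ?thesis using lower[OF assms] upper[OF assms(2,1)] y(1)[of k] by simp
qed

end

section \<open>Sixth roots of unity modulo n\<close>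

locale hex_modulus =
  fixes t n r :: int
  assumes t2: "2 \<le> t"
    and n_def: "n = 9 * t * t - 3 * t + 1"
    and r_def: "r = 3 * t * t - 2 * t + 1"
begin

text \<open>Modulo \<open>n\<close> the six values are the powers of \<open>w = 3 t\<close>, since
  \<open>w^2 = w - 1\<close> and \<open>w^3 = -1\<close>.\<close>

definition close :: "int \<Rightarrow> bool" where
  "close z \<longleftrightarrow> (\<exists>\<delta>\<in>{1, 3 * t, 3 * t - 1, - 1, - (3 * t), 1 - 3 * t}. n dvd z - \<delta>)"

lemma r_ge: "9 \<le> r"
proof -
  have "0 \<le> (t - 2) * (3 * t + 4)" using t2 by simp
  then show ?thesis unfolding r_def by (simp add: algebra_simps)
qed

lemma n_eq: "n = 3 * r + 3 * t - 2"
  by (simp add: n_def r_def algebra_simps)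

lemma n_gt: "6 * t < n"
proof -
  have "0 \<le> (t - 2) * (9 * t + 9)" using t2 by simp
  then show ?thesis unfolding n_def using t2 by (simp add: algebra_simps)
qed

lemma inverse_r: "(3 * t + 1) * r = t * n + 1"
  by (simp add: n_def r_def algebra_simps)

lemma not_dvd_small: "\<lbrakk>0 < z; z < n\<rbrakk> \<Longrightarrow> \<not> n dvd z" "\<lbrakk>- n < z; z < 0\<rbrakk> \<Longrightarrow> \<not> n dvd z"
  using zdvd_not_zless[of z n] zdvd_not_zless[of "- z" n] by auto

lemma close_cong: "n dvd a - b \<Longrightarrow> close a \<longleftrightarrow> close b"
proof -
  assume ab: "n dvd a - b"
  have "n dvd a - \<delta> \<longleftrightarrow> n dvd b - \<delta>" for \<delta>
    using dvd_add_right_iff[OF ab, of "b - \<delta>"] by simp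
  then show ?thesis by (simp add: close_def)
qed

lemma close_mod: "close (a mod n - b mod n) \<longleftrightarrow> close (a - b)"
  by (rule close_cong) (simp add: mod_eq_dvd_iff[symmetric] mod_diff_eq)

lemma close_minus: "close (- z) \<longleftrightarrow> close z"
proof -
  have *: "close (- z)" if h: "close z" for z
  proof -
    obtain \<delta> where d: "\<delta> \<in> {1, 3 * t, 3 * t - 1, - 1, - (3 * t), 1 - 3 * t}" "n dvd z - \<delta>"
      using h unfolding close_def by blast
    have "- \<delta> \<in> {1, 3 * t, 3 * t - 1, - 1, - (3 * t), 1 - 3 * t}"
      using d(1) by (elim insertE emptyE) (simp_all only: minus_minus minus_diff_eq insert_iff simp_thms)
    moreover have "- (z - \<delta>) = - z - (- \<delta>)" by simp
    then have "n dvd - z - (- \<delta>)" using d(2) dvd_minus_iff by metis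
    ultimately show ?thesis unfolding close_def by blast
  qed
  show ?thesis using *[of z] *[of "- z"] by auto
qed

text \<open>Multiplication by \<open>3 t\<close> permutes the six residues in the cycle
  \<open>1\<close>, \<open>3 t\<close>, \<open>3 t - 1\<close>, \<open>- 1\<close>,
  \<open>- 3 t\<close>, \<open>1 - 3 t\<close>.\<close>

lemma close_times_3t: "close z \<Longrightarrow> close (3 * t * z)"
proof -
  assume "close z"
  then obtain \<delta> where d: "\<delta> \<in> {1, 3 * t, 3 * t - 1, - 1, - (3 * t), 1 - 3 * t}" "n dvd z - \<delta>"
    unfolding close_def by blast
  have *: "n dvd 3 * t * z - \<epsilon>" if "n dvd 3 * t * \<delta> - \<epsilon>" for \<epsilon>
  proof -
    have "n dvd 3 * t * (z - \<delta>) + (3 * t * \<delta> - \<epsilon>)" using d(2) that by simp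
    then show ?thesis by (simp add: algebra_simps)
  qed
  have e: "3 * t * (3 * t) - (3 * t - 1) = n" "3 * t * (3 * t - 1) - (- 1) = n"
      "3 * t * (- (3 * t)) - (1 - 3 * t) = - n" "3 * t * (1 - 3 * t) - 1 = - n"
    by (simp_all add: n_def algebra_simps)
  have "\<exists>\<epsilon>\<in>{1, 3 * t, 3 * t - 1, - 1, - (3 * t), 1 - 3 * t}. 3 * t * \<delta> - \<epsilon> \<in> {0, n, - n}"
    using d(1)
  proof (elim insertE emptyE)
    assume "\<delta> = 1" then show ?thesis by (intro bexI[of _ "3 * t"]) auto
  next
    assume "\<delta> = 3 * t" then show ?thesis using e(1) by (intro bexI[of _ "3 * t - 1"]) auto
  next
    assume "\<delta> = 3 * t - 1" then show ?thesis using e(2) by (intro bexI[of _ "- 1"]) auto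
  next
    assume "\<delta> = - 1" then show ?thesis by (intro bexI[of _ "- (3 * t)"]) auto
  next
    assume "\<delta> = - (3 * t)" then show ?thesis using e(3) by (intro bexI[of _ "1 - 3 * t"]) auto
  next
    assume "\<delta> = 1 - 3 * t" then show ?thesis using e(4) by (intro bexI[of _ 1]) auto
  qed
  then have "\<exists>\<epsilon>\<in>{1, 3 * t, 3 * t - 1, - 1, - (3 * t), 1 - 3 * t}. n dvd 3 * t * \<delta> - \<epsilon>"
    by (metis dvd_0_right dvd_minus_iff dvd_refl empty_iff insert_iff)
  then show ?thesis using * unfolding close_def by blast
qed

lemma close_mult: "\<lbrakk>close a; close b\<rbrakk> \<Longrightarrow> close (a * b)"
proof -
  assume a: "close a" and b: "close b"
  obtain \<delta> where d: "\<delta> \<in> {1, 3 * t, 3 * t - 1, - 1, - (3 * t), 1 - 3 * t}" "n dvd a - \<delta>"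
    using a unfolding close_def by blast
  have w: "close (3 * t * b)" using close_times_3t b by blast
  have "n dvd (3 * t - 1) * b - 3 * t * (3 * t * b)"
  proof -
    have "(3 * t - 1) * b - 3 * t * (3 * t * b) = n * (- b)" by (simp add: n_def algebra_simps)
    then show ?thesis by simp
  qed
  then have w2: "close ((3 * t - 1) * b)" using close_cong close_times_3t[OF w] by blast
  have "- ((3 * t - 1) * b) = (1 - 3 * t) * b" by (simp add: algebra_simps)
  then have w3: "close ((1 - 3 * t) * b)" using w2 close_minus[of "(3 * t - 1) * b"] by simp
  have "close (\<delta> * b)"
    using d(1) b w w2 w3 close_minus[of b] close_minus[of "3 * t * b"] by auto
  moreover have "n dvd a * b - \<delta> * b" using d(2) by (metis dvd_mult2 left_diff_distrib)
  ultimately show ?thesis using close_cong by blast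
qed

lemma close_inverse:
  assumes "close a"
  obtains b where "close b" "n dvd a * b - 1"
proof -
  obtain \<delta> where d: "\<delta> \<in> {1, 3 * t, 3 * t - 1, - 1, - (3 * t), 1 - 3 * t}" "n dvd a - \<delta>"
    using assms unfolding close_def by blast
  have U: "close \<epsilon>" if "\<epsilon> \<in> {1, 3 * t, 3 * t - 1, - 1, - (3 * t), 1 - 3 * t}" for \<epsilon>
    unfolding close_def using that by (intro bexI[of _ \<epsilon>]) auto
  have e: "3 * t * (1 - 3 * t) - 1 = - n" "(3 * t - 1) * (- (3 * t)) - 1 = - n"
      "- (3 * t) * (3 * t - 1) - 1 = - n" "(1 - 3 * t) * (3 * t) - 1 = - n"
    by (simp_all add: n_def algebra_simps)
  have "\<exists>\<epsilon>\<in>{1, 3 * t, 3 * t - 1, - 1, - (3 * t), 1 - 3 * t}. \<delta> * \<epsilon> - 1 = 0 \<or> \<delta> * \<epsilon> - 1 = - n"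
    using d(1)
  proof (elim insertE emptyE)
    assume "\<delta> = 1" then show ?thesis by (intro bexI[of _ 1]) auto
  next
    assume "\<delta> = 3 * t" then show ?thesis using e by (intro bexI[of _ "1 - 3 * t"]) auto
  next
    assume "\<delta> = 3 * t - 1" then show ?thesis using e by (intro bexI[of _ "- (3 * t)"]) auto
  next
    assume "\<delta> = - 1" then show ?thesis by (intro bexI[of _ "- 1"]) auto
  next
    assume "\<delta> = - (3 * t)" then show ?thesis using e by (intro bexI[of _ "3 * t - 1"]) auto
  next
    assume "\<delta> = 1 - 3 * t" then show ?thesis using e by (intro bexI[of _ "3 * t"]) auto
  qed
  then obtain \<epsilon> where \<epsilon>: "\<epsilon> \<in> {1, 3 * t, 3 * t - 1, - 1, - (3 * t), 1 - 3 * t}" "n dvd \<delta> * \<epsilon> - 1"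
    by (metis dvd_0_right dvd_minus_iff dvd_refl)
  have "n dvd (a - \<delta>) * \<epsilon> + (\<delta> * \<epsilon> - 1)" by (intro dvd_add dvd_mult2 d(2) \<epsilon>(2))
  then have "n dvd a * \<epsilon> - 1" by (simp add: algebra_simps)
  then show thesis using that U[OF \<epsilon>(1)] by blast
qed

lemma close_cancel:
  assumes "close m"
  shows "n dvd m * z \<longleftrightarrow> n dvd z" "close (m * z) \<longleftrightarrow> close z"
proof -
  obtain b where b: "close b" "n dvd m * b - 1" using close_inverse[OF assms] .
  have "b * (m * z) - z = (m * b - 1) * z" by (simp add: algebra_simps)
  then have bz: "n dvd b * (m * z) - z" using b(2) by simp
  show "n dvd m * z \<longleftrightarrow> n dvd z"
  proof
    assume "n dvd m * z"
    then have "n dvd b * (m * z)" by simp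
    then show "n dvd z" using dvd_diff[OF _ bz, of "b * (m * z)"] by simp
  qed simp
  show "close (m * z) \<longleftrightarrow> close z"
  proof
    assume "close (m * z)"
    then have "close (b * (m * z))" using close_mult b by blast
    then show "close z" using close_cong[OF bz] by simp
  qed (use close_mult assms in blast)
qed

text \<open>The preimage of an independent \<open>K\<close> under reduction modulo \<open>n\<close>
  would be a \<open>strip\<close> with \<kappa> equal to 0, which \<open>kappa_nonzero\<close>
  excludes.\<close>

lemma no_independent_set:
  assumes K: "K \<subseteq> {0..<n}" "int (card K) = r"
  shows "\<exists>x\<in>K. \<exists>y\<in>K. x \<noteq> y \<and> close (x - y)"
proof (rule ccontr)
  assume "\<not> ?thesis"
  then have indep: "\<not> close (x - y)" if "x \<in> K" "y \<in> K" "x \<noteq> y" for x y using that by blast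
  define X where "X = {x. x mod n \<in> K}"
  have n0: "0 < n" using n_gt t2 by simp
  interpret strip t n r 0 X
  proof
    show "2 \<le> t" "n = 9 * t * t - 3 * t + 1" "r = 3 * t * t - 2 * t + 1" by (fact t2 n_def r_def)+
    show "(x \<in> X) = (x + n \<in> X)" for x by (simp add: X_def)
    have "X \<inter> {0..<n} = K" using K(1) by (auto simp: X_def)
    then show "int (card (X \<inter> {0..<n})) = r" using K(2) by simp
    show "(0::int) = 1 \<and> n dvd x \<and> y = x + 3 * t"
      if xy: "x \<in> X" "y \<in> X" "y - x \<in> {1, 3 * t - 1, 3 * t}" for x y
    proof -
      have "close (y - x)" unfolding close_def using xy(3) by (intro bexI[of _ "y - x"]) auto
      then have "close (y mod n - x mod n)" using close_mod by simp
      moreover have "\<not> n dvd y - x" using not_dvd_small(1)[of "y - x"] xy(3) n_gt t2 by auto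
      then have "y mod n \<noteq> x mod n" by (simp add: mod_eq_dvd_iff)
      ultimately show ?thesis using indep[of "y mod n" "x mod n"] xy by (simp add: X_def)
    qed
  qed auto
  show False using kappa_nonzero by simp
qed

text \<open>The factor \<open>(1 - 3 t) (v - u)\<close> is the unit that takes \<open>3 t\<close> to \<open>v - u\<close>.\<close>

definition place :: "int \<Rightarrow> int \<Rightarrow> int \<Rightarrow> int" where
  "place u v k = (u + (1 - 3 * t) * (v - u) * ((3 * t + 1) * k - 1)) mod n"

lemma multiplier:
  assumes "close (v - u)"
  shows "close ((1 - 3 * t) * (v - u))" "n dvd (1 - 3 * t) * (v - u) * (3 * t) - (v - u)"
proof -
  have "close (1 - 3 * t)" unfolding close_def by (intro bexI[of _ "1 - 3 * t"]) auto
  then show "close ((1 - 3 * t) * (v - u))" using close_mult assms by blast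
  have "(1 - 3 * t) * (v - u) * (3 * t) - (v - u) = n * (- (v - u))" by (simp add: n_def algebra_simps)
  then show "n dvd (1 - 3 * t) * (v - u) * (3 * t) - (v - u)" by simp
qed

section \<open>The extremal progression and its uniqueness\<close>

lemma place_diff:
  "n dvd (place u v k - place u v l) - (1 - 3 * t) * (v - u) * ((3 * t + 1) * (k - l))"
proof -
  define m where "m = (1 - 3 * t) * (v - u)"
  have "n dvd (place u v k - place u v l) - ((u + m * ((3 * t + 1) * k - 1)) - (u + m * ((3 * t + 1) * l - 1)))"
    unfolding place_def m_def by (simp add: mod_eq_dvd_iff[symmetric] mod_diff_eq)
  then show ?thesis by (simp add: m_def algebra_simps)
qed

text \<open>By \<open>inverse_r\<close>, \<open>r\<close> is the inverse of \<open>3 t + 1\<close>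
  modulo \<open>n\<close>.\<close>

lemma dvd_inverse_r: "n dvd (3 * t + 1) * d - \<delta> \<Longrightarrow> n dvd d - r * \<delta>"
proof -
  assume "n dvd (3 * t + 1) * d - \<delta>"
  then have "n dvd r * ((3 * t + 1) * d - \<delta>) - n * (t * d)" by (intro dvd_diff) auto
  moreover have "r * ((3 * t + 1) * d - \<delta>) - n * (t * d) = ((3 * t + 1) * r - t * n) * d - r * \<delta>"
    by (simp add: algebra_simps)
  ultimately show ?thesis by (simp add: inverse_r)
qed

lemma inj_place:
  assumes "close (v - u)"
  shows "inj_on (place u v) {1..r}"
proof (rule inj_onI)
  fix k l assume kl: "k \<in> {1..r}" "l \<in> {1..r}" "place u v k = place u v l"
  have "n dvd (1 - 3 * t) * (v - u) * ((3 * t + 1) * (k - l))" using place_diff[of u v k l] kl by simp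
  then have "n dvd (3 * t + 1) * (k - l)" using close_cancel(1)[OF multiplier(1)[OF assms]] by blast
  then have "n dvd k - l" using dvd_inverse_r[of "k - l" 0] by simp
  moreover have "- n < k - l" "k - l < n" using kl n_eq r_ge t2 by auto
  ultimately show "k = l" using not_dvd_small[of "k - l"] by (metis linorder_neqE_linordered_idom right_minus_eq)
qed

lemma place_ends:
  assumes "close (v - u)" "u \<in> {0..<n}" "v \<in> {0..<n}"
  shows "place u v r = u" "place u v 1 = v"
proof -
  have "(3 * t + 1) * r - 1 = n * t" using inverse_r by (simp add: mult.commute)
  then have "place u v r = (u + n * ((1 - 3 * t) * (v - u) * t)) mod n"
    unfolding place_def by (simp add: algebra_simps)
  then show "place u v r = u" using assms by simp
  have "n dvd (u + (1 - 3 * t) * (v - u) * (3 * t)) - v"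
    using multiplier(2)[OF assms(1)] by (simp add: algebra_simps)
  then have "(u + (1 - 3 * t) * (v - u) * (3 * t)) mod n = v mod n" by (simp add: mod_eq_dvd_iff)
  then show "place u v 1 = v" using assms by (simp add: place_def)
qed

lemma place_image:
  assumes "close (v - u)"
  shows "place u v ` {1..r} \<subseteq> {0..<n}" "int (card (place u v ` {1..r})) = r"
proof -
  show "place u v ` {1..r} \<subseteq> {0..<n}" using n_gt t2 by (auto simp: place_def)
  show "int (card (place u v ` {1..r})) = r" using card_image[OF inj_place[OF assms]] r_ge by simp
qed

text \<open>The index difference \<open>d\<close> satisfies \<open>d = r \<delta>\<close> modulo
  \<open>n\<close>, so up to sign it is congruent to \<open>r\<close>, \<open>1 - r\<close> or
  \<open>1 - 2 r\<close>. Since \<open>n > 3 r\<close> and \<open>- r < d < r\<close>, only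
  \<open>1 - r\<close> and \<open>r - 1\<close> remain.\<close>

lemma place_close_only_ends:
  assumes uv: "close (v - u)"
    and kl: "k \<in> {1..r}" "l \<in> {1..r}" "close (place u v k - place u v l)"
  shows "k = 1 \<and> l = r \<or> k = r \<and> l = 1"
proof -
  define d where "d = k - l"
  have d: "- r < d" "d < r" using kl(1,2) by (auto simp: d_def)
  have "close ((1 - 3 * t) * (v - u) * ((3 * t + 1) * d))"
    using close_cong[OF place_diff[of u v k l]] kl(3) by (simp add: d_def)
  then have "close ((3 * t + 1) * d)" using close_cancel(2)[OF multiplier(1)[OF uv]] by blast
  then obtain \<delta> where \<delta>: "\<delta> \<in> {1, 3 * t, 3 * t - 1, - 1, - (3 * t), 1 - 3 * t}" "n dvd (3 * t + 1) * d - \<delta>"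
    unfolding close_def by blast
  have dr: "n dvd d - r * \<delta>" using dvd_inverse_r[OF \<delta>(2)] .
  have r3t: "r * (3 * t) = n * t + 1 - r" using inverse_r by (simp add: algebra_simps)
  have shift: "n dvd z" if "n dvd z + n * c" for z c
    using that by (simp add: dvd_add_left_iff)
  have small: "z = 0" if "n dvd z" "- n < z" "z < n" for z
    using not_dvd_small[of z] that by (metis linorder_neqE_linordered_idom)
  from \<delta>(1) show ?thesis
  proof (elim insertE emptyE)
    assume "\<delta> = 1"
    then have "d - r = 0" using dr d n_eq t2 r_ge by (intro small) auto
    then show ?thesis using d by simp
  next
    assume "\<delta> = 3 * t"
    then have eq: "d - r * \<delta> = (d - 1 + r) + n * (- t)" using r3t by simp
    have "n dvd d - 1 + r" using dr unfolding eq by (rule shift)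
    then have "d - 1 + r = 0" using d n_eq t2 r_ge by (intro small) auto
    then show ?thesis using kl(1,2) by (auto simp: d_def)
  next
    assume "\<delta> = 3 * t - 1"
    then have "r * \<delta> = r * (3 * t) - r" by (simp only: right_diff_distrib mult.right_neutral)
    then have eq: "d - r * \<delta> = (d - 1 + 2 * r) + n * (- t)" using r3t by simp
    have "n dvd d - 1 + 2 * r" using dr unfolding eq by (rule shift)
    then have "d - 1 + 2 * r = 0" using d n_eq t2 r_ge by (intro small) auto
    then show ?thesis using d r_ge by simp
  next
    assume "\<delta> = - 1"
    then have "d + r = 0" using dr d n_eq t2 r_ge by (intro small) auto
    then show ?thesis using d by simp
  next
    assume "\<delta> = - (3 * t)"
    then have eq: "d - r * \<delta> = (d + 1 - r) + n * t" using r3t by simp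
    have "n dvd d + 1 - r" using dr unfolding eq by (rule shift)
    then have "d + 1 - r = 0" using d n_eq t2 r_ge by (intro small) auto
    then show ?thesis using kl(1,2) by (auto simp: d_def)
  next
    assume "\<delta> = 1 - 3 * t"
    then have "r * \<delta> = r - r * (3 * t)" by (simp only: right_diff_distrib mult.right_neutral)
    then have eq: "d - r * \<delta> = (d + 1 - 2 * r) + n * t" using r3t by simp
    have "n dvd d + 1 - 2 * r" using dr unfolding eq by (rule shift)
    then have "d + 1 - 2 * r = 0" using d n_eq t2 r_ge by (intro small) auto
    then show ?thesis using d r_ge by simp
  qed
qed

text \<open>Pulled back along the affine map \<open>f\<close> with \<open>f 0 = u\<close> and
  \<open>f (3 t) = v\<close>, \<open>K\<close> becomes a \<open>strip\<close> with \<kappa> equal to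
  1. Then \<open>progression_in_X\<close> puts the progression inside \<open>K\<close>, and the
  cardinalities agree.\<close>

lemma unique_extension:
  assumes K: "K \<subseteq> {0..<n}" "int (card K) = r" "u \<in> K" "v \<in> K" "close (v - u)"
    and only: "\<And>x y. \<lbrakk>x \<in> K; y \<in> K; x \<noteq> y; close (x - y)\<rbrakk> \<Longrightarrow> {x, y} = {u, v}"
  shows "K = place u v ` {1..r}"
proof -
  define m where "m = (1 - 3 * t) * (v - u)"
  define f where "f y = (u + m * y) mod n" for y
  define X where "X = {y. f y \<in> K}"
  have n0: "0 < n" using n_gt t2 by simp
  have cm: "close m" and m3t: "n dvd m * (3 * t) - (v - u)" using multiplier[OF K(5)] by (simp_all add: m_def)
  have uv: "0 \<le> u" "u < n" "0 \<le> v" "v < n" using K by auto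
  have f_eq: "f x = f y \<longleftrightarrow> n dvd x - y" for x y
  proof -
    have "f x = f y \<longleftrightarrow> n dvd m * (x - y)"
      unfolding f_def mod_eq_dvd_iff by (simp add: algebra_simps)
    then show ?thesis using close_cancel(1)[OF cm] by simp
  qed
  have f0: "f 0 = u" using uv by (simp add: f_def)
  have "n dvd (u + m * (3 * t)) - v" using m3t by (simp add: algebra_simps)
  then have "f (3 * t) = v mod n" unfolding f_def by (simp add: mod_eq_dvd_iff)
  then have f3t: "f (3 * t) = v" using uv by simp
  have inj: "inj_on f {0..<n}"
  proof (rule inj_onI)
    fix x y assume xy: "x \<in> {0..<n}" "y \<in> {0..<n}" "f x = f y"
    then have "x mod n = y mod n" using f_eq unfolding mod_eq_dvd_iff by simp
    then show "x = y" using xy(1,2) by (metis atLeastLessThan_iff mod_pos_pos_trivial)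
  qed
  have "f ` {0..<n} \<subseteq> {0..<n}" using n0 by (auto simp: f_def)
  then have surj: "f ` {0..<n} = {0..<n}" using inj by (intro endo_inj_surj) auto
  interpret strip t n r 1 X
  proof
    show "2 \<le> t" "n = 9 * t * t - 3 * t + 1" "r = 3 * t * t - 2 * t + 1" by (fact t2 n_def r_def)+
    have "f (x + n) = f x" for x using f_eq by simp
    then show "(x \<in> X) = (x + n \<in> X)" for x by (simp add: X_def)
    have "f ` (X \<inter> {0..<n}) = K"
    proof
      show "K \<subseteq> f ` (X \<inter> {0..<n})"
      proof
        fix k assume k: "k \<in> K"
        then obtain y where "y \<in> {0..<n}" "f y = k" using surj K(1) by (metis imageE subsetD)
        then show "k \<in> f ` (X \<inter> {0..<n})" using k by (intro image_eqI[of _ _ y]) (auto simp: X_def)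
      qed
    qed (auto simp: X_def)
    moreover have "card (f ` (X \<inter> {0..<n})) = card (X \<inter> {0..<n})"
      using inj by (intro card_image) (auto intro: inj_on_subset)
    ultimately show "int (card (X \<inter> {0..<n})) = r" using K(2) by simp
    show "(1::int) = 1 \<and> n dvd x \<and> y = x + 3 * t"
      if xy: "x \<in> X" "y \<in> X" "y - x \<in> {1, 3 * t - 1, 3 * t}" for x y
    proof -
      have d: "0 < y - x" "y - x \<le> 3 * t" using xy(3) t2 by auto
      have "close (y - x)" unfolding close_def using xy(3) by (intro bexI[of _ "y - x"]) auto
      then have "close (m * (y - x))" using close_cancel(2)[OF cm] by simp
      then have "close ((u + m * y) - (u + m * x))" by (simp add: algebra_simps)
      then have "close (f y - f x)" unfolding f_def using close_mod by simp
      moreover have "\<not> n dvd y - x" using not_dvd_small(1)[of "y - x"] d n_gt t2 by simp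
      then have "f y \<noteq> f x" using f_eq by simp
      ultimately have "{f y, f x} = {u, v}" using only xy by (simp add: X_def)
      then consider "f x = u" "f y = v" | "f x = v" "f y = u" by (auto simp: doubleton_eq_iff)
      then show ?thesis
      proof cases
        case 1
        then have nx: "n dvd x" and ny: "n dvd y - 3 * t"
          using f_eq[of x 0] f_eq[of y "3 * t"] f0 f3t by auto
        have "n dvd (y - 3 * t) - x" using ny nx by (rule dvd_diff)
        then have "y - 3 * t - x = 0" using not_dvd_small(2)[of "y - 3 * t - x"] d n_gt t2 by force
        then show ?thesis using nx by simp
      next
        \<comment> \<open>The reversed orientation would make \<open>y - x + 3 t\<close>, which lies
          strictly between 0 and \<open>n\<close>, divisible by \<open>n\<close>.\<close>
        case 2
        then have nx: "n dvd x - 3 * t" and ny: "n dvd y"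
          using f_eq[of x "3 * t"] f_eq[of y 0] f0 f3t by auto
        have "n dvd y - (x - 3 * t)" using ny nx by (rule dvd_diff)
        then have False using not_dvd_small(1)[of "y - (x - 3 * t)"] d n_gt t2 by simp
        then show ?thesis ..
      qed
    qed
    show "0 \<in> X \<and> 3 * t \<in> X" using f0 f3t K by (simp add: X_def)
  qed auto
  have "place u v k \<in> K" if "k \<in> {1..r}" for k
    using progression_in_X[of k] that by (simp add: X_def f_def place_def m_def)
  then have "place u v ` {1..r} \<subseteq> K" by blast
  moreover have "finite K" using K(1) finite_subset by blast
  moreover have "card (place u v ` {1..r}) = card K" using place_image(2)[OF K(5)] K(2) by simp
  ultimately show ?thesis using card_subset_eq by metis
qed

end

section \<open>The Cayley complement\<close>

context
  fixes t n r :: nat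
  assumes t2: "t \<ge> 2" and n_def: "n = 9 * t ^ 2 - 3 * t + 1" and r_def: "r = 3 * t ^ 2 - 2 * t + 1"
begin

text \<open>The subtractions on natural numbers are not truncated here.\<close>

lemma int_parameters:
  "int n = 9 * int t * int t - 3 * int t + 1" "int r = 3 * int t * int t - 2 * int t + 1"
proof -
  have "2 * t \<le> t ^ 2" using t2 by (simp add: power2_eq_square)
  then have "3 * t \<le> 9 * t ^ 2" "2 * t \<le> 3 * t ^ 2" by linarith+
  then show "int n = 9 * int t * int t - 3 * int t + 1" "int r = 3 * int t * int t - 2 * int t + 1"
    unfolding n_def r_def by (simp_all add: of_nat_diff power2_eq_square mult.assoc)
qed

interpretation hex_modulus "int t" "int n" "int r"
  by unfold_locales (use t2 int_parameters in auto)

abbreviation (input) "\<Gamma> \<equiv> integer_mod_group n"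
abbreviation (input) "S \<equiv> {1, 3 * int t - 1, 3 * int t}"
abbreviation (input) "H \<equiv> cayley_complement \<Gamma> S"

lemma n_pos: "0 < int n"
  using hex_modulus.n_gt[OF hex_modulus_axioms] t2 by linarith

lemma carrier_\<Gamma>: "carrier \<Gamma> = {0..<int n}"
  using n_pos by (simp add: carrier_integer_mod_group)

lemma cayley_step_iff:
  assumes "x \<in> {0..<int n}" "y \<in> {0..<int n}"
  shows "(\<exists>z\<in>S. x = y \<otimes>\<^bsub>\<Gamma>\<^esub> z \<or> x = y \<otimes>\<^bsub>\<Gamma>\<^esub> inv\<^bsub>\<Gamma>\<^esub> z) \<longleftrightarrow> close (x - y)"
proof -
  have S: "z \<in> carrier \<Gamma>" if "z \<in> S" for z
    using that n_gt t2 unfolding carrier_\<Gamma> by auto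
  have eq: "x = (y + w) mod int n \<longleftrightarrow> int n dvd (x - y) - w" for w
  proof -
    have "x = (y + w) mod int n \<longleftrightarrow> x mod int n = (y + w) mod int n" using assms by simp
    also have "\<dots> \<longleftrightarrow> int n dvd x - (y + w)" by (rule mod_eq_dvd_iff)
    finally show ?thesis by (simp add: diff_diff_eq)
  qed
  have inv: "y \<otimes>\<^bsub>\<Gamma>\<^esub> inv\<^bsub>\<Gamma>\<^esub> z = (y + - z) mod int n" if "z \<in> S" for z
    using inv_integer_mod_group[OF S[OF that]] by (simp add: mod_add_right_eq)
  have "(\<exists>z\<in>S. x = y \<otimes>\<^bsub>\<Gamma>\<^esub> z \<or> x = y \<otimes>\<^bsub>\<Gamma>\<^esub> inv\<^bsub>\<Gamma>\<^esub> z)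
      \<longleftrightarrow> (\<exists>z\<in>S. int n dvd (x - y) - z \<or> int n dvd (x - y) - (- z))"
    using inv eq by (intro bex_cong refl) (simp only: mult_integer_mod_group)
  also have "\<dots> \<longleftrightarrow> close (x - y)"
    unfolding close_def by (simp only: bex_simps minus_diff_eq) blast
  finally show ?thesis .
qed

lemma cayley_adjacent_iff:
  assumes "x \<in> {0..<int n}" "y \<in> {0..<int n}"
  shows "adjacent (cayley_graph \<Gamma> S) x y \<longleftrightarrow> x \<noteq> y \<and> close (x - y)"
proof
  assume "adjacent (cayley_graph \<Gamma> S) x y"
  then obtain a b where ab: "{x, y} = {a, b}" "a \<in> {0..<int n}" "b \<in> {0..<int n}" "a \<noteq> b"
      "\<exists>z\<in>S. a = b \<otimes>\<^bsub>\<Gamma>\<^esub> z \<or> a = b \<otimes>\<^bsub>\<Gamma>\<^esub> inv\<^bsub>\<Gamma>\<^esub> z"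
    unfolding adjacent_def cayley_graph_def carrier_\<Gamma> snd_conv by blast
  then have "close (a - b)" using cayley_step_iff by blast
  then have "close (b - a)" using close_minus[of "a - b"] by simp
  then show "x \<noteq> y \<and> close (x - y)" using ab(1,4) \<open>close (a - b)\<close> by (auto simp: doubleton_eq_iff)
next
  assume xy: "x \<noteq> y \<and> close (x - y)"
  then have "\<exists>z\<in>S. x = y \<otimes>\<^bsub>\<Gamma>\<^esub> z \<or> x = y \<otimes>\<^bsub>\<Gamma>\<^esub> inv\<^bsub>\<Gamma>\<^esub> z" using cayley_step_iff[OF assms] by blast
  then show "adjacent (cayley_graph \<Gamma> S) x y"
    unfolding adjacent_def cayley_graph_def carrier_\<Gamma> snd_conv using assms xy by blast
qed

lemma vertices_H: "vertices H = {0..<int n}"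
  by (simp add: cayley_complement_def graph_complement_def cayley_graph_def carrier_\<Gamma>)

lemma edge_H_iff:
  "{x, y} \<in> edges H \<longleftrightarrow> x \<in> {0..<int n} \<and> y \<in> {0..<int n} \<and> x \<noteq> y \<and> \<not> close (x - y)"
proof -
  have vert: "vertices (cayley_graph \<Gamma> S) = {0..<int n}" by (simp add: cayley_graph_def carrier_\<Gamma>)
  show ?thesis
  proof
    assume "{x, y} \<in> edges H"
    then obtain a b where ab: "{x, y} = {a, b}" "a \<in> {0..<int n}" "b \<in> {0..<int n}" "a \<noteq> b"
        "\<not> adjacent (cayley_graph \<Gamma> S) a b"
      unfolding cayley_complement_def graph_complement_def vert snd_conv by blast
    then have "\<not> close (a - b)" using cayley_adjacent_iff by blast
    then have "\<not> close (b - a)" using close_minus[of "a - b"] by simp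
    then show "x \<in> {0..<int n} \<and> y \<in> {0..<int n} \<and> x \<noteq> y \<and> \<not> close (x - y)"
      using ab(1-4) \<open>\<not> close (a - b)\<close> unfolding doubleton_eq_iff by blast
  next
    assume xy: "x \<in> {0..<int n} \<and> y \<in> {0..<int n} \<and> x \<noteq> y \<and> \<not> close (x - y)"
    then have "\<not> adjacent (cayley_graph \<Gamma> S) x y" using cayley_adjacent_iff by blast
    then show "{x, y} \<in> edges H"
      unfolding cayley_complement_def graph_complement_def vert snd_conv using xy by blast
  qed
qed

section \<open>Cliques in the Cayley complement\<close>

lemma clique_H:
  "is_clique_of_size r H K \<longleftrightarrow>
     K \<subseteq> {0..<int n} \<and> card K = r \<and> (\<forall>x\<in>K. \<forall>y\<in>K. x \<noteq> y \<longrightarrow> \<not> close (x - y))"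
  unfolding is_clique_of_size_def vertices_H clique_def edge_H_iff by blast

lemma clique_add_edge:
  "is_clique_of_size r (add_edge H u v) K \<longleftrightarrow>
     K \<subseteq> {0..<int n} \<and> card K = r \<and>
     (\<forall>x\<in>K. \<forall>y\<in>K. x \<noteq> y \<longrightarrow> close (x - y) \<longrightarrow> {x, y} = {u, v})"
proof -
  have VE: "vertices (add_edge H u v) = {0..<int n}" "edges (add_edge H u v) = insert {u, v} (edges H)"
    using vertices_H by (simp_all add: add_edge_def)
  show ?thesis unfolding is_clique_of_size_def clique_def VE insert_iff edge_H_iff by blast
qed

lemma no_clique: "\<not> is_clique_of_size r H K"
  using no_independent_set[of K] unfolding clique_H by auto

lemma unique_clique:
  assumes "u \<in> {0..<int n}" "v \<in> {0..<int n}" "u \<noteq> v" "\<not> adjacent H u v"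
  shows "\<exists>!K. is_clique_of_size r (add_edge H u v) K"
proof -
  have cuv: "close (u - v)" using assms edge_H_iff[of u v] by (simp add: adjacent_def)
  then have cvu: "close (v - u)" using close_minus[of "u - v"] by simp
  show ?thesis
  proof (rule ex1I[of _ "place u v ` {1..int r}"])
    have "{x, y} = {u, v}" if "x \<in> place u v ` {1..int r}" "y \<in> place u v ` {1..int r}" "close (x - y)" for x y
    proof -
      obtain k l where kl: "k \<in> {1..int r}" "l \<in> {1..int r}" "x = place u v k" "y = place u v l"
        using \<open>x \<in> _\<close> \<open>y \<in> _\<close> by blast
      then have "k = 1 \<and> l = int r \<or> k = int r \<and> l = 1"
        using place_close_only_ends[OF cvu kl(1,2)] \<open>close (x - y)\<close> by simp
      then show ?thesis using kl place_ends[OF cvu assms(1,2)] by (auto simp: doubleton_eq_iff)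
    qed
    then show "is_clique_of_size r (add_edge H u v) (place u v ` {1..int r})"
      unfolding clique_add_edge using place_image[OF cvu] by auto
  next
    fix K assume "is_clique_of_size r (add_edge H u v) K"
    then have K: "K \<subseteq> {0..<int n}" "int (card K) = int r"
      and only: "\<And>x y. \<lbrakk>x \<in> K; y \<in> K; x \<noteq> y; close (x - y)\<rbrakk> \<Longrightarrow> {x, y} = {u, v}"
      unfolding clique_add_edge by auto
    \<comment> \<open>A set of \<open>r\<close> residues contains two close elements, and in a
      clique of the extended graph these can only be \<open>u\<close> and \<open>v\<close>.\<close>
    obtain x y where "x \<in> K" "y \<in> K" "x \<noteq> y" "close (x - y)" using no_independent_set[OF K] by blast
    then have "u \<in> K" "v \<in> K" using only[of x y] by (auto simp: doubleton_eq_iff)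
    then show "K = place u v ` {1..int r}" using unique_extension[OF K _ _ cvu] only by blast
  qed
qed

lemma simple_H: "finite_simple_graph H"
proof -
  have "e \<subseteq> {0..<int n} \<and> card e = 2" if e_edge: "e \<in> edges H" for e
  proof -
    obtain x y where e: "e = {x, y}"
      using e_edge unfolding cayley_complement_def graph_complement_def snd_conv by blast
    then show ?thesis using e_edge edge_H_iff[of x y] by auto
  qed
  then show ?thesis unfolding finite_simple_graph_def vertices_H by simp
qed

lemma no_dominating: "\<not> dominating_vertex H v"
proof
  assume "dominating_vertex H v"
  then have v: "v \<in> {0..<int n}" and dom: "\<And>u. \<lbrakk>u \<in> {0..<int n}; u \<noteq> v\<rbrakk> \<Longrightarrow> {v, u} \<in> edges H"
    unfolding dominating_vertex_def vertices_H adjacent_def by auto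
  \<comment> \<open>The residue after \<open>v\<close> is adjacent to \<open>v\<close> in the Cayley
    graph through the generator 1, hence not in the complement.\<close>
  define u where "u = (v + 1) mod int n"
  have u: "u \<in> {0..<int n}" using n_pos by (simp add: u_def)
  have "int n dvd v + 1 - u" by (simp add: u_def minus_mod_eq_mult_div)
  then have "int n dvd (v - u) - (- 1)" by (simp add: algebra_simps)
  then have c: "close (v - u)" unfolding close_def by blast
  moreover have "u \<noteq> v"
  proof
    assume "u = v"
    then have "int n dvd 1" using \<open>int n dvd v + 1 - u\<close> by simp
    then show False using n_gt t2 by simp
  qed
  ultimately show False using dom[OF u] edge_H_iff[of v u] by blast
qed

lemma primitive_H: "primitive_graph r H"
proof -
  have "r \<le> n" using n_eq t2 by linarith
  then have "r \<le> card (vertices H)" unfolding vertices_H by simp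
  then show ?thesis
    unfolding primitive_graph_def uniquely_saturated_def
    using simple_H no_clique unique_clique no_dominating by (simp add: vertices_H)
qed

end

theorem theorem3:
  fixes t n r :: nat
  assumes "t \<ge> 2"
    and "n = 9 * t ^ 2 - 3 * t + 1"
    and "r = 3 * t ^ 2 - 2 * t + 1"
  shows "primitive_graph r
           (cayley_complement (integer_mod_group n) {1, 3 * int t - 1, 3 * int t})"
  using primitive_H[OF assms] .

end
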